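(* Let $V$ satisfy assumptions (A1)--(A2) (stated in the context). Let $A\subset\Omega$ be a nonempty open subset whose closure is not $V$-invariant. Assume that $A$ satisfies the following uniform-orbit cone condition: there are numbers $r_0>0$ and $\beta_0\in(0,\pi/2)$ such that for each $x\in A$ there is a point $p\in A\cap\mathrm{Orbit}(x)$ and a direction $\nu_p\in\mathbb S^1$ such that $$\big\{p+s\xi:\ 0<s\le r_0,\ \xi\in\mathbb S^1,\ \xi\cdot\nu_p>\cos\beta_0\big\}\subset A.$$ Suppose also that $$d:=d\big(A,\{T=0,+\infty\}\big)>0\quad\text{and}\quad\kappa:=\inf_{x\in A}|\nabla T(x)|>0.$$ Write $E:=\mathrm{Orbit}(A)\setminus A$ and $E(t):=\Phi(t)(E)$ for $t\ge0$. Then there is a constant $C=C(\Omega,V,d,\kappa,r_0,\beta_0)>0$ such that $$C^{-1}(1+t)^{-1}\sup_{x_0\in E}d(x_0,E^\complement)\le\rho\big(E(t)\big)\le\rho_A\big(E(t)\big)\le C(1+t)^{-1},\qquad t\ge0,$$ where, for $\emptyset\ne F\subset\mathrm{Orbit}(A)$, $$\rho(F):=\sup_{x\in F}d\big(x,F^\complement\big)\quad\text{and}\quad\rho_A(F):=\sup_{x\in F}d\big(x,F^\complement\cap\mathrm{Orbit}(A)\big).$$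
   Context: $\Omega\subset\mathbb R^2$ is a bounded Lipschitz domain (open, connected) and $V\in C^1(\overline\Omega;\mathbb R^2)$ (meaning $V$ is $C^1$ on some open set containing $\overline\Omega$) is a time-independent vector field with $\operatorname{div}V=0$ in $\Omega$ and $V\cdot\vec n=0$ on $\partial\Omega$ ($\vec n$ the outward unit normal). Assumptions: (A1) There is $H\in C^2(\mathbb R^2)$ with $V=(\partial_2H,-\partial_1H)^\top$ in $\overline\Omega$ and $H=0$ on $\partial\Omega$. (A2) $H$ has finitely many critical points $x_1^*,\dots,x_K^*$ on $\overline\Omega$, and for each $k$ there are a real number $m_k\ge1$ and a symmetric nonsingular $S_k\in\mathbb R^{2\times2}$ such that $H(x_k^*+y)-H(x_k^* )=\frac12|y|^{m_k-1}y^\top S_ky+R_k(y)$ for $y$ near $0$, where $R_k\in C^2(\mathbb R^2)$ and $\|D^jR_k(y)\|=o(|y|^{m_k+1-j})$ as $y\to0$, $j=0,1,2$. Flow: for $x_0\in\overline\Omega$, $x(\cdot;x_0)$ solves $x'(t)=V(x(t))$, $t\in\mathbb R$, $x(0)=x_0$, and $\Phi(t)(x_0):=x(t;x_0)$. Orbit period: $T(x_0):=\inf\{\hat t>0: x(\hat t;x_0)=x_0\}\in[0,+\infty]$ for $x_0\in\overline\Omega$, with $T(x_0)=+\infty$ if the set is empty. $T$ is $C^1$ on the set $\{0<T<+\infty\}$, so $\nabla T$ makes sense there. $\{T=0,+\infty\}$ is the set of points where $T$ is $0$ or $+\infty$. $d(\cdot,\cdot)$ is the Euclidean distance (between points and/or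 sets), equal to $+\infty$ by convention if one of the sets is empty. For $E\subset\overline\Omega$, $\mathrm{Orbit}(E):=\bigcup_{t\in\mathbb R}\Phi(t)(E)$ and $\mathrm{Orbit}(x):=\mathrm{Orbit}(\{x\})$; $E$ is called $V$-invariant if $\mathrm{Orbit}(E)=E$. $\mathbb S^1$ is the unit circle in $\mathbb R^2$; $F^\complement:=\mathbb R^2\setminus F$. $C(\ldots)$ denotes a constant depending only on the listed parameters. *)

theory Defs
  imports "HOL-Analysis.Analysis" "HOL-Library.Landau_Symbols"
begin

definition grad :: "('a::real_inner \<Rightarrow> real) \<Rightarrow> 'a \<Rightarrow> 'a" where
  "grad f x = (THE D. GDERIV f x :> D)"

definition divergence :: "(real^2 \<Rightarrow> real^2) \<Rightarrow> real^2 \<Rightarrow> real" where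
  "divergence V x = (\<Sum>i\<in>UNIV. frechet_derivative V (at x) (axis i 1) $ i)"

definition C1_on :: "('a::real_normed_vector) set \<Rightarrow> ('a \<Rightarrow> 'b::real_normed_vector) \<Rightarrow> bool" where
  "C1_on U f \<longleftrightarrow> (\<exists>f' :: 'a \<Rightarrow> 'a \<Rightarrow>\<^sub>L 'b.
     (\<forall>x\<in>U. (f has_derivative blinfun_apply (f' x)) (at x)) \<and> continuous_on U f')"

definition C2 :: "('a::real_inner \<Rightarrow> real) \<Rightarrow> bool" where
  "C2 f \<longleftrightarrow> (\<forall>x. GDERIV f x :> grad f x) \<and> C1_on UNIV (grad f)"

definition C1_closure :: "(real^2) set \<Rightarrow> (real^2 \<Rightarrow> real^2) \<Rightarrow> bool" where
  "C1_closure \<Omega> V \<longleftrightarrow> (\<exists>U. open U \<and> closure \<Omega> \<subseteq> U \<and> C1_on U V)"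

text \<open>Near each boundary point \<open>p\<close>, in orthonormal coordinates \<open>(u, w)\<close> centred at \<open>p\<close>, the set is the
  region strictly above a Lipschitz graph (so its boundary there is the graph itself).\<close>

definition lipschitz_domain :: "(real^2) set \<Rightarrow> bool" where
  "lipschitz_domain \<Omega> \<longleftrightarrow> open \<Omega> \<and> connected \<Omega> \<and> \<Omega> \<noteq> {} \<and>
     (\<forall>p\<in>frontier \<Omega>. \<exists>r>0. \<exists>u w \<gamma> L.
        norm u = 1 \<and> norm w = 1 \<and> u \<bullet> w = 0 \<and> L-lipschitz_on UNIV (\<gamma> :: real \<Rightarrow> real) \<and>
        \<Omega> \<inter> ball p r = {x \<in> ball p r. \<gamma> ((x - p) \<bullet> u) < (x - p) \<bullet> w})"

text \<open>The outward unit normal at \<open>x\<close>: to first order at \<open>x\<close>, the set is the half-plane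
  \<open>{y. (y - x) \<bullet> n < 0}\<close>. For a Lipschitz domain it exists exactly at the boundary points at which the
  local graph function is differentiable, hence almost everywhere on the boundary, and it is unique
  there. For a continuous field, vanishing of the normal component at almost all boundary points and
  at all points with a normal are the same.\<close>

definition outward_normal :: "(real^2) set \<Rightarrow> real^2 \<Rightarrow> real^2 \<Rightarrow> bool" where
  "outward_normal \<Omega> x n \<longleftrightarrow> norm n = 1 \<and> (\<forall>\<epsilon>>0. \<forall>\<^sub>F y in at x.
     ((y - x) \<bullet> n < - \<epsilon> * norm (y - x) \<longrightarrow> y \<in> \<Omega>) \<and>
     ((y - x) \<bullet> n > \<epsilon> * norm (y - x) \<longrightarrow> y \<notin> \<Omega>))"

definition tangential :: "(real^2) set \<Rightarrow> (real^2 \<Rightarrow> real^2) \<Rightarrow> bool" where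
  "tangential \<Omega> V \<longleftrightarrow> (\<forall>x\<in>frontier \<Omega>. \<forall>n. outward_normal \<Omega> x n \<longrightarrow> V x \<bullet> n = 0)"

definition assm_A1 :: "(real^2) set \<Rightarrow> (real^2 \<Rightarrow> real^2) \<Rightarrow> (real^2 \<Rightarrow> real) \<Rightarrow> bool" where
  "assm_A1 \<Omega> V H \<longleftrightarrow> C2 H \<and>
     (\<forall>x\<in>closure \<Omega>. V x = vector [grad H x $ 2, - (grad H x $ 1)]) \<and>
     (\<forall>x\<in>frontier \<Omega>. H x = 0)"

definition critical_points :: "(real^2) set \<Rightarrow> (real^2 \<Rightarrow> real) \<Rightarrow> (real^2) set" where
  "critical_points \<Omega> H = {x \<in> closure \<Omega>. grad H x = 0}"

definition assm_A2 :: "(real^2) set \<Rightarrow> (real^2 \<Rightarrow> real) \<Rightarrow> bool" where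
  "assm_A2 \<Omega> H \<longleftrightarrow> finite (critical_points \<Omega> H) \<and>
     (\<forall>z\<in>critical_points \<Omega> H. \<exists>(m::real) (S::real^2^2) R.
        m \<ge> 1 \<and> transpose S = S \<and> invertible S \<and> C2 R \<and>
        (\<forall>\<^sub>F y in nhds 0.
           H (z + y) - H z = 1 / 2 * norm y powr (m - 1) * (y \<bullet> (S *v y)) + R y) \<and>
        R \<in> o[at 0](\<lambda>y. norm y powr (m + 1)) \<and>
        (\<lambda>y. norm (grad R y)) \<in> o[at 0](\<lambda>y. norm y powr m) \<and>
        (\<lambda>y. onorm (frechet_derivative (grad R) (at y))) \<in> o[at 0](\<lambda>y. norm y powr (m - 1)))"

text \<open>\<open>\<Phi>\<close> is the flow of \<open>V\<close> on \<open>closure \<Omega>\<close>. The field is only meaningful on \<open>closure \<Omega>\<close>, so a solution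
  takes its values there; values of \<open>\<Phi>\<close> off \<open>closure \<Omega>\<close> are irrelevant.\<close>

definition is_flow :: "(real^2) set \<Rightarrow> (real^2 \<Rightarrow> real^2) \<Rightarrow> (real \<Rightarrow> real^2 \<Rightarrow> real^2) \<Rightarrow> bool" where
  "is_flow \<Omega> V \<Phi> \<longleftrightarrow> (\<forall>x0\<in>closure \<Omega>. \<Phi> 0 x0 = x0 \<and>
     (\<forall>t. \<Phi> t x0 \<in> closure \<Omega> \<and> ((\<lambda>s. \<Phi> s x0) has_vector_derivative V (\<Phi> t x0)) (at t)))"

definition orbit :: "(real \<Rightarrow> 'a \<Rightarrow> 'a) \<Rightarrow> 'a set \<Rightarrow> 'a set" where
  "orbit \<Phi> E = (\<Union>t. \<Phi> t ` E)"

definition flow_invariant :: "(real \<Rightarrow> 'a \<Rightarrow> 'a) \<Rightarrow> 'a set \<Rightarrow> bool" where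
  "flow_invariant \<Phi> E \<longleftrightarrow> orbit \<Phi> E = E"

text \<open>The infimum is taken in \<open>ereal\<close>, where it is \<open>\<infinity>\<close> on the empty set.\<close>

definition period :: "(real \<Rightarrow> 'a \<Rightarrow> 'a) \<Rightarrow> 'a \<Rightarrow> ereal" where
  "period \<Phi> x = Inf (ereal ` {t. t > 0 \<and> \<Phi> t x = x})"

definition degenerate_set :: "(real^2) set \<Rightarrow> (real \<Rightarrow> real^2 \<Rightarrow> real^2) \<Rightarrow> (real^2) set" where
  "degenerate_set \<Omega> \<Phi> = {x \<in> closure \<Omega>. period \<Phi> x = 0 \<or> period \<Phi> x = \<infinity>}"

definition grad_period :: "(real \<Rightarrow> real^2 \<Rightarrow> real^2) \<Rightarrow> real^2 \<Rightarrow> real^2" where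
  "grad_period \<Phi> = grad (\<lambda>x. real_of_ereal (period \<Phi> x))"

definition orbit_cone_condition ::
    "(real \<Rightarrow> real^2 \<Rightarrow> real^2) \<Rightarrow> (real^2) set \<Rightarrow> real \<Rightarrow> real \<Rightarrow> bool" where
  "orbit_cone_condition \<Phi> A r0 \<beta>0 \<longleftrightarrow>
     (\<forall>x\<in>A. \<exists>p \<in> A \<inter> orbit \<Phi> {x}. \<exists>\<nu>. norm \<nu> = 1 \<and>
        {p + s *\<^sub>R \<xi> | s \<xi>. 0 < s \<and> s \<le> r0 \<and> norm \<xi> = 1 \<and> \<xi> \<bullet> \<nu> > cos \<beta>0} \<subseteq> A)"

text \<open>The library's \<open>setdist\<close> is \<open>0\<close> if one of the sets is empty; here the convention is \<open>\<infinity>\<close>.\<close>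

definition esetdist :: "'a::metric_space set \<Rightarrow> 'a set \<Rightarrow> ereal" where
  "esetdist A B = (if A = {} \<or> B = {} then \<infinity> else ereal (setdist A B))"

definition rho :: "'a::metric_space set \<Rightarrow> ereal" where
  "rho F = (SUP x\<in>F. esetdist {x} (- F))"

definition rho_rel :: "(real \<Rightarrow> 'a \<Rightarrow> 'a) \<Rightarrow> 'a::metric_space set \<Rightarrow> 'a set \<Rightarrow> ereal" where
  "rho_rel \<Phi> A F = (SUP x\<in>F. esetdist {x} (- F \<inter> orbit \<Phi> A))"

end

theory Submission
  imports Defs
begin

text \<open>On the nondegenerate periodic points the period \<open>P\<close> is locally Lipschitz: the displacement
  \<open>V x \<bullet> (\<Phi> t y - y)\<close> vanishes near \<open>t = P x\<close> by the intermediate value theorem, and a zero closes the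
  orbit because \<open>H\<close> is conserved. No boundary regularity is needed for this, since \<open>H\<close> is \<open>C\<^sup>2\<close> on the
  whole plane. In the interior \<open>P\<close> is differentiable with gradient orthogonal to \<open>V\<close>.

  Both bounds reduce time \<open>t\<close> modulo the period. For the lower bound, \<open>t mod P a\<close> and \<open>t mod P b\<close>
  differ by at most about \<open>(t / P) \<bar>P a - P b\<bar>\<close>, so \<open>\<Phi> t\<close> is Lipschitz with constant \<open>O(1 + t)\<close> and its
  inverse shrinks balls no faster. For the upper bound, write the target as \<open>x = \<Phi> \<tau> p\<close> with
  \<open>0 \<le> \<tau> < P p\<close> and walk from \<open>p\<close> into the cone in a direction along which \<open>P\<close> is strictly monotone:
  after a distance \<open>O(1 / t)\<close> one meets a point \<open>y\<close> for which \<open>t - \<tau>\<close> is an integer multiple of \<open>P y\<close>,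
  and then \<open>\<Phi> t y = \<Phi> \<tau> y\<close> is close to \<open>x\<close>.\<close>

section \<open>Gronwall bounds and differentiability\<close>

text \<open>\<open>C\<close> may depend on \<open>d\<close>, \<open>\<kappa>\<close>,
  \<open>r0\<close> and \<open>\<beta>0\<close> but not on \<open>A\<close>, so no constant may be
  extracted from \<open>A\<close> or its closure. All of them come from one compact set fixed
  beforehand: the points at distance at least some real \<open>d0 \<le> d\<close> from the
  degenerate points, saturated under the flow so that it also contains the orbits of
  \<open>A\<close>. This set may meet the boundary of the domain, which is why periods are compared
  and shown Lipschitz relative to the closure, with derivatives taken only inside. The gradient
  \<open>grad_period\<close> is a definite description and says nothing until the period is known to
  be differentiable; hence the work on differentiating the flow in its initial point. After that,
  orthogonality to \<open>V\<close> fixes the direction of the gradient in the plane, and a cone of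
  fixed opening always contains a direction transversal to \<open>V\<close>. This turns a bound on
  the norm of the gradient into a rate of change of the period.\<close>

lemma gronwall_bound:
  fixes w w' :: "real \<Rightarrow> 'a::real_inner"
  assumes w: "\<And>s. (w has_vector_derivative w' s) (at s)"
    and b: "\<And>s. \<bar>s\<bar> \<le> \<bar>t\<bar> \<Longrightarrow> norm (w' s) \<le> L * norm (w s) + e"
    and "L \<ge> 0" "e \<ge> 0"
  shows "norm (w t) \<le> (norm (w 0) + e) * exp ((L + 1) * \<bar>t\<bar>)"
proof -
  have fwd: "norm (w t) \<le> (norm (w 0) + e) * exp ((L + 1) * t)"
    if w: "\<And>s. (w has_vector_derivative w' s) (at s)"
      and b: "\<And>s. 0 \<le> s \<Longrightarrow> s \<le> t \<Longrightarrow> norm (w' s) \<le> L * norm (w s) + e" and "t \<ge> 0"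
    for w w' :: "real \<Rightarrow> 'a" and t :: real
  proof -
    define c where "c = 2 * (L + 1)"
    \<comment> \<open>Squares replace norms, which are not differentiable at 0. The rate
      \<open>L + 1\<close> instead of \<open>L\<close> absorbs the mixed term
      \<open>2 * norm (w s) * e\<close>, and the added \<open>e\<^sup>2\<close> absorbs the part
      that does not vanish with \<open>w\<close>.\<close>
    define u where "u = (\<lambda>s. (w s \<bullet> w s + e\<^sup>2) * exp (- (c * s)))"
    have "u t \<le> u 0"
    proof (rule DERIV_nonpos_imp_nonincreasing[OF \<open>t \<ge> 0\<close>])
      fix s assume s: "0 \<le> s" "s \<le> t"
      have dw: "((\<lambda>s. w s \<bullet> w s) has_real_derivative 2 * (w s \<bullet> w' s)) (at s)"
      proof -
        have "((\<lambda>s. w s \<bullet> w s) has_vector_derivative (w s \<bullet> w' s + w' s \<bullet> w s)) (at s)"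
          by (rule bounded_bilinear.has_vector_derivative[OF bounded_bilinear_inner w w])
        then show ?thesis
          by (simp add: has_real_derivative_iff_has_vector_derivative inner_commute)
      qed
      have du: "(u has_real_derivative
          (2 * (w s \<bullet> w' s) - c * (w s \<bullet> w s + e\<^sup>2)) * exp (- (c * s))) (at s)"
        unfolding u_def
        by (auto intro!: derivative_eq_intros dw simp: algebra_simps)
      have "w s \<bullet> w' s \<le> norm (w s) * norm (w' s)"
        by (rule norm_cauchy_schwarz)
      also have "\<dots> \<le> norm (w s) * (L * norm (w s) + e)"
        using b[OF s] by (intro mult_left_mono) auto
      also have "2 * \<dots> \<le> c * (w s \<bullet> w s + e\<^sup>2)"
      proof -
        have "2 * (norm (w s) * e) \<le> (norm (w s))\<^sup>2 + e\<^sup>2"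
          using sum_squares_bound[of "norm (w s)" e] by simp
        moreover have "0 \<le> L * e\<^sup>2"
          using \<open>L \<ge> 0\<close> by simp
        moreover have "0 \<le> (norm (w s))\<^sup>2"
          by simp
        moreover have "2 * (norm (w s) * (L * norm (w s) + e)) = 2 * (L * (norm (w s))\<^sup>2) + 2 * (norm (w s) * e)"
          by (simp add: power2_eq_square distrib_left)
        moreover have "c * (w s \<bullet> w s + e\<^sup>2) = 2 * (L * (norm (w s))\<^sup>2) + 2 * (L * e\<^sup>2) + 2 * (norm (w s))\<^sup>2 + 2 * e\<^sup>2"
          by (simp add: c_def power2_norm_eq_inner algebra_simps)
        ultimately show ?thesis
          using zero_le_power2[of e] by linarith
      qed
      finally have "2 * (w s \<bullet> w' s) - c * (w s \<bullet> w s + e\<^sup>2) \<le> 0"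
        by simp
      with du show "\<exists>y. (u has_real_derivative y) (at s) \<and> y \<le> 0"
        by (intro exI conjI) (auto simp: mult_nonpos_nonneg)
    qed
    then have "w t \<bullet> w t + e\<^sup>2 \<le> (w 0 \<bullet> w 0 + e\<^sup>2) * exp (c * t)"
      unfolding u_def by (simp add: exp_minus field_simps)
    also have "\<dots> \<le> (norm (w 0) + e)\<^sup>2 * exp (c * t)"
      using \<open>e \<ge> 0\<close> by (intro mult_right_mono) (auto simp: power2_norm_eq_inner[symmetric] power2_sum)
    also have "\<dots> = ((norm (w 0) + e) * exp ((L + 1) * t))\<^sup>2"
      by (simp add: c_def power_mult_distrib exp_double[symmetric] mult.assoc)
    finally have "(norm (w t))\<^sup>2 \<le> ((norm (w 0) + e) * exp ((L + 1) * t))\<^sup>2"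
      using zero_le_power2[of e] unfolding power2_norm_eq_inner by linarith
    then show ?thesis
      by (rule power2_le_imp_le) (use \<open>e \<ge> 0\<close> in auto)
  qed
  show ?thesis
  proof (cases "t \<ge> 0")
    case True
    then show ?thesis using fwd[OF w b, of t] by auto
  next
    case False
    have "((\<lambda>s. w (- s)) has_vector_derivative - w' (- s)) (at s)" for s
      using vector_diff_chain_at[OF has_vector_derivative_minus[OF has_vector_derivative_id] w, of s]
      by (simp add: o_def)
    then show ?thesis
      using fwd[of "\<lambda>s. w (- s)" "\<lambda>s. - w' (- s)" "- t"] b False by auto
  qed
qed

text \<open>Cover \<open>K\<close> by balls on which \<open>f'\<close> varies little; a Lebesgue
  number \<open>\<delta>\<close> puts \<open>a\<close> and \<open>b\<close> in a common ball, which
  is convex, so the mean value inequality applies although \<open>K\<close> need not be convex. Only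
  \<open>a\<close> has to lie in \<open>K\<close>.\<close>

lemma C1_on_uniformly_differentiable:
  fixes f :: "'a::euclidean_space \<Rightarrow> 'b::real_normed_vector"
  assumes K: "compact K" "K \<subseteq> U" "open U"
    and f: "\<And>x. x \<in> U \<Longrightarrow> (f has_derivative blinfun_apply (f' x)) (at x)"
    and c: "continuous_on U f'"
    and "\<epsilon> > 0"
  obtains \<delta> where "\<delta> > 0"
    "\<And>a b. a \<in> K \<Longrightarrow> dist a b < \<delta> \<Longrightarrow> norm (f b - f a - blinfun_apply (f' a) (b - a)) \<le> \<epsilon> * norm (b - a)"
proof -
  have "\<exists>r>0. ball x r \<subseteq> U \<and> (\<forall>y\<in>ball x r. dist (f' y) (f' x) < \<epsilon> / 2)" if "x \<in> K" for x
  proof -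
    have "isCont f' x"
      using c K that continuous_on_eq_continuous_at by blast
    then obtain r1 where r1: "r1 > 0" "\<And>y. dist y x < r1 \<Longrightarrow> dist (f' y) (f' x) < \<epsilon> / 2"
      unfolding continuous_at_eps_delta using \<open>\<epsilon> > 0\<close> by (meson half_gt_zero)
    moreover obtain r2 where "r2 > 0" "ball x r2 \<subseteq> U"
      using openE[OF \<open>open U\<close>, of x] K(2) \<open>x \<in> K\<close> by blast
    ultimately show ?thesis
      by (intro exI[of _ "min r1 r2"]) (auto simp: dist_commute)
  qed
  then obtain r where r: "\<And>x. x \<in> K \<Longrightarrow> r x > 0" "\<And>x. x \<in> K \<Longrightarrow> ball x (r x) \<subseteq> U"
    "\<And>x y. x \<in> K \<Longrightarrow> y \<in> ball x (r x) \<Longrightarrow> dist (f' y) (f' x) < \<epsilon> / 2"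
    by metis
  obtain \<delta> where \<delta>: "\<delta> > 0" "\<And>x. x \<in> K \<Longrightarrow> \<exists>G\<in>(\<lambda>x. ball x (r x)) ` K. ball x \<delta> \<subseteq> G"
    by (rule Heine_Borel_lemma[OF K(1), of "(\<lambda>x. ball x (r x)) ` K"]) (use r in auto)
  show ?thesis
  proof (rule that[OF \<delta>(1)])
    fix a b assume ab: "a \<in> K" "dist a b < \<delta>"
    obtain x where x: "x \<in> K" "ball a \<delta> \<subseteq> ball x (r x)"
      using \<delta>(2)[OF ab(1)] by auto
    have a: "a \<in> ball x (r x)" and b: "b \<in> ball x (r x)"
      using x ab \<delta>(1) by (auto simp: subset_iff)
    have "norm (f b - f a - blinfun_apply (f' a) (b - a)) \<le> norm (b - a) * \<epsilon>"
    proof (rule differentiable_bound_linearization[where S = "ball x (r x)"])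
      show "a + t *\<^sub>R (b - a) \<in> ball x (r x)" if "t \<in> {0..1}" for t
        using convexD_alt[OF convex_ball a b, of t] that by (simp add: algebra_simps)
      show "(f has_derivative blinfun_apply (f' y)) (at y within ball x (r x))" if "y \<in> ball x (r x)" for y
        using f r(2)[OF x(1)] that has_derivative_at_withinI by blast
      show "onorm (blinfun_apply (f' y) - blinfun_apply (f' a)) \<le> \<epsilon>" if "y \<in> ball x (r x)" for y
      proof -
        have "dist (f' y) (f' a) \<le> \<epsilon>"
          using r(3)[OF x(1) that] r(3)[OF x(1) a] dist_triangle_half_r[of "f' x" "f' y" \<epsilon> "f' a"]
          by (simp add: dist_commute)
        then show ?thesis
          by (simp add: dist_norm norm_blinfun.rep_eq minus_blinfun.rep_eq fun_diff_def)
      qed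
      show "a \<in> ball x (r x)" by fact
    qed
    then show "norm (f b - f a - blinfun_apply (f' a) (b - a)) \<le> \<epsilon> * norm (b - a)"
      by (simp add: mult.commute)
  qed
qed

text \<open>Viewing \<open>f\<close> as a field over the single time 0 gives access to the
  local-to-global theorem for Lipschitz conditions on compact sets.\<close>

lemma lipschitz_on_compact_of_local:
  fixes f :: "'a::metric_space \<Rightarrow> 'b::metric_space"
  assumes "compact K"
    and "\<And>x. x \<in> K \<Longrightarrow> \<exists>u>0. \<exists>L. L-lipschitz_on (cball x u \<inter> K) f"
  obtains L where "L-lipschitz_on K f"
proof -
  have "local_lipschitz {0::real} K (\<lambda>_. f)"
    unfolding local_lipschitz_def using assms(2) by blast
  then obtain L where "\<And>t. t \<in> {0::real} \<Longrightarrow> L-lipschitz_on K f"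
    by (rule local_lipschitz_compact_implies_lipschitz[OF _ assms(1)]) auto
  then show ?thesis using that by auto
qed

text \<open>The difference quotients \<open>(f (x + s e) - f x) / s\<close> are Cauchy, so the derivative comes out of
  completeness and no candidate for it is needed.\<close>

lemma has_derivative_if_almost_linear:
  fixes f :: "real^2 \<Rightarrow> 'b::banach"
  assumes lin: "\<And>\<epsilon>. \<epsilon> > 0 \<Longrightarrow> \<exists>\<delta>>0. \<forall>h1 h2 h3 c1 c2 c3.
      norm h1 < \<delta> \<and> norm h2 < \<delta> \<and> norm h3 < \<delta> \<and> c1 *\<^sub>R h1 + c2 *\<^sub>R h2 + c3 *\<^sub>R h3 = 0 \<longrightarrow>
      norm (c1 *\<^sub>R (f (x + h1) - f x) + c2 *\<^sub>R (f (x + h2) - f x) + c3 *\<^sub>R (f (x + h3) - f x))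
        \<le> \<epsilon> * (\<bar>c1\<bar> * norm h1 + \<bar>c2\<bar> * norm h2 + \<bar>c3\<bar> * norm h3)"
  shows "\<exists>D. (f has_derivative D) (at x)"
proof -
  define g where "g h = f (x + h) - f x" for h
  have g0: "g 0 = 0" by (simp add: g_def)
  have axis: "\<exists>l. \<forall>\<epsilon>>0. \<exists>\<delta>>0. \<forall>s. \<bar>s\<bar> < \<delta> \<longrightarrow> norm (g (s *\<^sub>R e) - s *\<^sub>R l) \<le> \<epsilon> * \<bar>s\<bar>"
    if e: "norm e = 1" for e :: "real^2"
  proof -
    have quot: "\<exists>\<delta>>0. \<forall>s r. s \<noteq> 0 \<and> r \<noteq> 0 \<and> \<bar>s\<bar> < \<delta> \<and> \<bar>r\<bar> < \<delta> \<longrightarrow>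
        norm (g (s *\<^sub>R e) /\<^sub>R s - g (r *\<^sub>R e) /\<^sub>R r) \<le> \<epsilon>" if "\<epsilon> > 0" for \<epsilon> :: real
    proof -
      obtain \<delta> where \<delta>: "\<delta> > 0" and *: "\<forall>h1 h2 h3 c1 c2 c3.
          norm h1 < \<delta> \<and> norm h2 < \<delta> \<and> norm h3 < \<delta> \<and> c1 *\<^sub>R h1 + c2 *\<^sub>R h2 + c3 *\<^sub>R h3 = 0 \<longrightarrow>
          norm (c1 *\<^sub>R g h1 + c2 *\<^sub>R g h2 + c3 *\<^sub>R g h3)
            \<le> \<epsilon> / 2 * (\<bar>c1\<bar> * norm h1 + \<bar>c2\<bar> * norm h2 + \<bar>c3\<bar> * norm h3)"
        using lin[of "\<epsilon> / 2"] \<open>\<epsilon> > 0\<close> unfolding g_def by auto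
      \<comment> \<open>The relation used is \<open>s e / s - r e / r = 0\<close>; each of its two
        terms has weight 1, which is why \<open>lin\<close> was called with
        \<open>\<epsilon> / 2\<close>.\<close>
      have "norm (g (s *\<^sub>R e) /\<^sub>R s - g (r *\<^sub>R e) /\<^sub>R r) \<le> \<epsilon>"
        if "s \<noteq> 0" "r \<noteq> 0" "\<bar>s\<bar> < \<delta>" "\<bar>r\<bar> < \<delta>" for s r
        using *[rule_format, of "s *\<^sub>R e" "r *\<^sub>R e" 0 "inverse s" "- inverse r" 0] that e \<delta>
        by (simp add: abs_inverse)
      then show ?thesis using \<delta> by blast
    qed
    define q where "q n = g (inverse (real (Suc n)) *\<^sub>R e) /\<^sub>R inverse (real (Suc n))" for n
    have small: "\<exists>N. \<forall>n\<ge>N. inverse (real (Suc n)) < \<delta>" if "\<delta> > 0" for \<delta>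
      using LIMSEQ_inverse_real_of_nat[THEN order_tendstoD(2), OF that]
      by (simp add: eventually_sequentially)
    have "Cauchy q"
    proof (rule metric_CauchyI)
      fix \<epsilon> :: real assume "\<epsilon> > 0"
      then obtain \<delta> where \<delta>: "\<delta> > 0" "\<forall>s r. s \<noteq> 0 \<and> r \<noteq> 0 \<and> \<bar>s\<bar> < \<delta> \<and> \<bar>r\<bar> < \<delta> \<longrightarrow>
        norm (g (s *\<^sub>R e) /\<^sub>R s - g (r *\<^sub>R e) /\<^sub>R r) \<le> \<epsilon> / 2"
        using quot[of "\<epsilon> / 2"] by auto
      obtain N where N: "\<And>n. n \<ge> N \<Longrightarrow> inverse (real (Suc n)) < \<delta>"
        using small[OF \<delta>(1)] by auto
      have "dist (q m) (q n) < \<epsilon>" if "m \<ge> N" "n \<ge> N" for m n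
      proof -
        have "norm (q m - q n) \<le> \<epsilon> / 2"
          unfolding q_def using N that by (intro \<delta>(2)[rule_format]) auto
        then show ?thesis using \<open>\<epsilon> > 0\<close> by (simp add: dist_norm)
      qed
      then show "\<exists>M. \<forall>m\<ge>M. \<forall>n\<ge>M. dist (q m) (q n) < \<epsilon>" by blast
    qed
    then obtain l where l: "q \<longlonglongrightarrow> l"
      using Cauchy_convergent_iff convergent_def by blast
    have "\<exists>\<delta>>0. \<forall>s. \<bar>s\<bar> < \<delta> \<longrightarrow> norm (g (s *\<^sub>R e) - s *\<^sub>R l) \<le> \<epsilon> * \<bar>s\<bar>" if \<epsilon>: "\<epsilon> > 0" for \<epsilon>
    proof -
      obtain \<delta> where \<delta>: "\<delta> > 0" "\<forall>s r. s \<noteq> 0 \<and> r \<noteq> 0 \<and> \<bar>s\<bar> < \<delta> \<and> \<bar>r\<bar> < \<delta> \<longrightarrow>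
        norm (g (s *\<^sub>R e) /\<^sub>R s - g (r *\<^sub>R e) /\<^sub>R r) \<le> \<epsilon>"
        using quot[OF \<epsilon>] by auto
      obtain N where N: "\<And>n. n \<ge> N \<Longrightarrow> inverse (real (Suc n)) < \<delta>"
        using small[OF \<delta>(1)] by auto
      have "norm (g (s *\<^sub>R e) - s *\<^sub>R l) \<le> \<epsilon> * \<bar>s\<bar>" if s: "\<bar>s\<bar> < \<delta>" for s
      proof (cases "s = 0")
        case False
        have "(\<lambda>n. norm (g (s *\<^sub>R e) /\<^sub>R s - q n)) \<longlonglongrightarrow> norm (g (s *\<^sub>R e) /\<^sub>R s - l)"
          by (intro tendsto_intros l)
        moreover have "\<forall>\<^sub>F n in sequentially. norm (g (s *\<^sub>R e) /\<^sub>R s - q n) \<le> \<epsilon>"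
          unfolding eventually_sequentially q_def using N False s
          by (intro exI[of _ N] allI impI \<delta>(2)[rule_format]) auto
        ultimately have "norm (g (s *\<^sub>R e) /\<^sub>R s - l) \<le> \<epsilon>"
          by (intro tendsto_upperbound[of _ _ sequentially]) auto
        then have "\<bar>s\<bar> * norm (g (s *\<^sub>R e) /\<^sub>R s - l) \<le> \<bar>s\<bar> * \<epsilon>"
          by (intro mult_left_mono) auto
        moreover have "g (s *\<^sub>R e) - s *\<^sub>R l = s *\<^sub>R (g (s *\<^sub>R e) /\<^sub>R s - l)"
          using False by (simp add: algebra_simps)
        ultimately show ?thesis by (simp add: mult.commute)
      qed (simp add: g0)
      then show ?thesis using \<delta>(1) by blast
    qed
    then show ?thesis by blast
  qed
  have ax1: "norm (axis i 1 :: real^2) = 1" for i :: 2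
    by simp
  obtain l :: "2 \<Rightarrow> 'b" where l: "\<And>i \<epsilon>. \<epsilon> > 0 \<Longrightarrow>
      \<exists>\<delta>>0. \<forall>s. \<bar>s\<bar> < \<delta> \<longrightarrow> norm (g (s *\<^sub>R axis i 1) - s *\<^sub>R l i) \<le> \<epsilon> * \<bar>s\<bar>"
    using axis[OF ax1] by metis
  define D where "D h = (h $ 1) *\<^sub>R l 1 + (h $ 2) *\<^sub>R l 2" for h :: "real^2"
  have "bounded_linear D"
    unfolding D_def by (intro bounded_linear_add bounded_linear_scaleR_const bounded_linear_vec_nth)
  moreover have "\<exists>\<delta>>0. \<forall>y. norm (y - x) < \<delta> \<longrightarrow> norm (f y - f x - D (y - x)) \<le> \<epsilon> * norm (y - x)"
    if \<epsilon>: "\<epsilon> > 0" for \<epsilon>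
  proof -
    \<comment> \<open>The errors add up to the weight
      \<open>norm h + 2 * \<bar>h $ 1\<bar> + 2 * \<bar>h $ 2\<bar>\<close>, at most
      \<open>5 * norm h\<close>.\<close>
    obtain \<delta> where \<delta>: "\<delta> > 0" and *: "\<forall>h1 h2 h3 c1 c2 c3.
        norm h1 < \<delta> \<and> norm h2 < \<delta> \<and> norm h3 < \<delta> \<and> c1 *\<^sub>R h1 + c2 *\<^sub>R h2 + c3 *\<^sub>R h3 = 0 \<longrightarrow>
        norm (c1 *\<^sub>R g h1 + c2 *\<^sub>R g h2 + c3 *\<^sub>R g h3)
          \<le> \<epsilon> / 5 * (\<bar>c1\<bar> * norm h1 + \<bar>c2\<bar> * norm h2 + \<bar>c3\<bar> * norm h3)"
      using lin[of "\<epsilon> / 5"] \<epsilon> unfolding g_def by auto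
    obtain \<delta>1 where \<delta>1: "\<delta>1 > 0" "\<And>s. \<bar>s\<bar> < \<delta>1 \<Longrightarrow> norm (g (s *\<^sub>R axis 1 1) - s *\<^sub>R l 1) \<le> \<epsilon> / 5 * \<bar>s\<bar>"
      using l[of "\<epsilon> / 5" 1] \<epsilon> by auto
    obtain \<delta>2 where \<delta>2: "\<delta>2 > 0" "\<And>s. \<bar>s\<bar> < \<delta>2 \<Longrightarrow> norm (g (s *\<^sub>R axis 2 1) - s *\<^sub>R l 2) \<le> \<epsilon> / 5 * \<bar>s\<bar>"
      using l[of "\<epsilon> / 5" 2] \<epsilon> by auto
    have gD: "norm (g h - D h) \<le> \<epsilon> * norm h" if h: "norm h < Min {\<delta>, \<delta>1, \<delta>2}" for h
    proof -
      have c: "\<bar>h $ 1\<bar> \<le> norm h" "\<bar>h $ 2\<bar> \<le> norm h"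
        by (rule component_le_norm_cart)+
      have h12: "h = (h $ 1) *\<^sub>R axis 1 1 + (h $ 2) *\<^sub>R axis 2 1"
        by (simp add: vec_eq_iff forall_2 axis_def)
      have n: "norm ((h $ i) *\<^sub>R (axis i 1 :: real^2)) = \<bar>h $ i\<bar>" for i
        by simp
      have g1: "norm (g h - g ((h $ 1) *\<^sub>R axis 1 1) - g ((h $ 2) *\<^sub>R axis 2 1))
          \<le> \<epsilon> / 5 * (norm h + \<bar>h $ 1\<bar> + \<bar>h $ 2\<bar>)"
        using *[rule_format, of h "(h $ 1) *\<^sub>R axis 1 1" "(h $ 2) *\<^sub>R axis 2 1" 1 "-1" "-1"] h c h12
        by (simp add: n algebra_simps)
      have g2: "norm (g ((h $ 1) *\<^sub>R axis 1 1) - (h $ 1) *\<^sub>R l 1) \<le> \<epsilon> / 5 * \<bar>h $ 1\<bar>"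
        and g3: "norm (g ((h $ 2) *\<^sub>R axis 2 1) - (h $ 2) *\<^sub>R l 2) \<le> \<epsilon> / 5 * \<bar>h $ 2\<bar>"
        using h c by (auto intro!: \<delta>1(2) \<delta>2(2) simp del: times_divide_eq_left)
      have "norm (g h - D h) \<le> \<epsilon> / 5 * (norm h + \<bar>h $ 1\<bar> + \<bar>h $ 2\<bar>)
          + \<epsilon> / 5 * \<bar>h $ 1\<bar> + \<epsilon> / 5 * \<bar>h $ 2\<bar>"
      proof -
        have "g h - D h = (g h - g ((h $ 1) *\<^sub>R axis 1 1) - g ((h $ 2) *\<^sub>R axis 2 1))
            + (g ((h $ 1) *\<^sub>R axis 1 1) - (h $ 1) *\<^sub>R l 1)
            + (g ((h $ 2) *\<^sub>R axis 2 1) - (h $ 2) *\<^sub>R l 2)"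
          by (simp add: D_def)
        then show ?thesis
          by (simp only:) (intro norm_triangle_mono g1 g2 g3)
      qed
      also have "\<dots> = \<epsilon> / 5 * (norm h + 2 * \<bar>h $ 1\<bar> + 2 * \<bar>h $ 2\<bar>)"
        by (simp add: algebra_simps)
      also have "\<dots> \<le> \<epsilon> / 5 * (5 * norm h)"
        using c \<epsilon> by (intro mult_left_mono) auto
      finally show ?thesis by simp
    qed
    have "norm (f y - f x - D (y - x)) \<le> \<epsilon> * norm (y - x)" if "norm (y - x) < Min {\<delta>, \<delta>1, \<delta>2}" for y
      using gD[OF that]
      by (simp add: g_def)
    moreover have "Min {\<delta>, \<delta>1, \<delta>2} > 0"
      using \<delta>(1) \<delta>1(1) \<delta>2(1) by simp
    ultimately show ?thesis by blast
  qed
  ultimately show ?thesis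
    unfolding has_derivative_at_alt by blast
qed

section \<open>Hamiltonian flows and their periods\<close>

text \<open>The data of the theorem reduced to estimates on the compact closure. One constant
  \<open>L\<close> bounds the field, its derivative and its Lipschitz quotient. The expansion of
  \<open>V\<close> is uniform over pairs of points of the closure, even if the segment between them
  leaves it.\<close>

locale hamiltonian_flow =
  fixes \<Omega> :: "(real^2) set" and V :: "real^2 \<Rightarrow> real^2" and V' :: "real^2 \<Rightarrow> (real^2) \<Rightarrow>\<^sub>L (real^2)"
    and H :: "real^2 \<Rightarrow> real" and \<Phi> :: "real \<Rightarrow> real^2 \<Rightarrow> real^2" and L :: real
  assumes flow: "is_flow \<Omega> V \<Phi>"
    and bounded_domain: "bounded \<Omega>" and open_domain: "open \<Omega>"
    and L_ge_1: "L \<ge> 1"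
    and V_lipschitz: "L-lipschitz_on (closure \<Omega>) V"
    and V_bound: "\<And>x. x \<in> closure \<Omega> \<Longrightarrow> norm (V x) \<le> L"
    and V'_bound: "\<And>x. x \<in> closure \<Omega> \<Longrightarrow> norm (V' x) \<le> L"
    and V_differentiable: "\<And>\<epsilon>. \<epsilon> > 0 \<Longrightarrow> \<exists>\<delta>>0. \<forall>a\<in>closure \<Omega>. \<forall>b\<in>closure \<Omega>. dist a b < \<delta> \<longrightarrow>
      norm (V b - V a - blinfun_apply (V' a) (b - a)) \<le> \<epsilon> * norm (b - a)"
    and H_gradient: "\<And>x. GDERIV H x :> grad H x"
    and H_gradient_cont: "continuous_on UNIV (grad H)"
    and V_eq: "\<And>x. x \<in> closure \<Omega> \<Longrightarrow> V x = vector [grad H x $ 2, - (grad H x $ 1)]"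
begin

abbreviation X where "X \<equiv> closure \<Omega>"
abbreviation N where "N \<equiv> X - degenerate_set \<Omega> \<Phi>"
text \<open>The period \<open>\<infinity>\<close> becomes 0 here, so \<open>P\<close> carries
  information only on \<open>N\<close>, the points of positive finite period.\<close>

definition P where "P x = real_of_ereal (period \<Phi> x)"

lemma L_pos: "L > 0"
  using L_ge_1 by simp

lemma compact_X: "compact X"
  using bounded_domain by (simp add: compact_closure)

lemma \<Phi>_0 [simp]: "x \<in> X \<Longrightarrow> \<Phi> 0 x = x"
  using flow by (auto simp: is_flow_def)

lemma \<Phi>_in [simp, intro]: "x \<in> X \<Longrightarrow> \<Phi> t x \<in> X"
  using flow by (auto simp: is_flow_def)

lemma \<Phi>_deriv: "x \<in> X \<Longrightarrow> ((\<lambda>s. \<Phi> s x) has_vector_derivative V (\<Phi> t x)) (at t)"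
  using flow by (auto simp: is_flow_def)

lemma V_lip: "a \<in> X \<Longrightarrow> b \<in> X \<Longrightarrow> norm (V a - V b) \<le> L * norm (a - b)"
  using lipschitz_onD[OF V_lipschitz] by (simp add: dist_norm)

lemma solutions_dist:
  assumes "\<And>t. y t \<in> X" "\<And>t. z t \<in> X"
    and "\<And>t. (y has_vector_derivative V (y t)) (at t)" "\<And>t. (z has_vector_derivative V (z t)) (at t)"
  shows "norm (y t - z t) \<le> norm (y 0 - z 0) * exp ((L + 1) * \<bar>t\<bar>)"
  using gronwall_bound[of "\<lambda>t. y t - z t" "\<lambda>t. V (y t) - V (z t)" t L 0] assms L_pos V_lip
  by (auto intro!: has_vector_derivative_diff)

text \<open>Two solutions with the same initial point do not separate. The group law, the rest
  points and the agreement of any two flows of \<open>V\<close> on the closure are all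
  instances.\<close>

lemma solution_unique:
  assumes "\<And>t. y t \<in> X" "\<And>t. (y has_vector_derivative V (y t)) (at t)"
  shows "y t = \<Phi> t (y 0)"
  using solutions_dist[of y "\<lambda>t. \<Phi> t (y 0)" t] assms \<Phi>_deriv by auto

lemma \<Phi>_dist:
  assumes "a \<in> X" "b \<in> X"
  shows "norm (\<Phi> t a - \<Phi> t b) \<le> norm (a - b) * exp ((L + 1) * \<bar>t\<bar>)"
  using solutions_dist[of "\<lambda>t. \<Phi> t a" "\<lambda>t. \<Phi> t b" t] assms \<Phi>_deriv by auto

lemma \<Phi>_add:
  assumes "x \<in> X"
  shows "\<Phi> (s + t) x = \<Phi> s (\<Phi> t x)"
proof -
  have "((\<lambda>s. \<Phi> (s + t) x) has_vector_derivative V (\<Phi> (s + t) x)) (at s)" for s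
    using vector_diff_chain_at[OF has_vector_derivative_add[OF has_vector_derivative_id has_vector_derivative_const] \<Phi>_deriv[OF assms], of t s]
    by (simp add: o_def)
  then show ?thesis
    using solution_unique[of "\<lambda>s. \<Phi> (s + t) x" s] assms by auto
qed

lemma \<Phi>_minus [simp]: "x \<in> X \<Longrightarrow> \<Phi> (- t) (\<Phi> t x) = x" "x \<in> X \<Longrightarrow> \<Phi> t (\<Phi> (- t) x) = x"
  using \<Phi>_add[of x "- t" t] \<Phi>_add[of x t "- t"] by auto

lemma \<Phi>_inj: "a \<in> X \<Longrightarrow> b \<in> X \<Longrightarrow> \<Phi> t a = \<Phi> t b \<longleftrightarrow> a = b"
  by (metis \<Phi>_minus(1))

lemma \<Phi>_time_dist:
  assumes "x \<in> X"
  shows "norm (\<Phi> s x - \<Phi> t x) \<le> L * \<bar>s - t\<bar>"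
proof -
  have "onorm (\<lambda>h. h *\<^sub>R V (\<Phi> r x)) \<le> L" for r
    using V_bound[of "\<Phi> r x"] assms
    by (intro onorm_bound) (auto simp: L_pos less_imp_le mult.commute[of L] intro: mult_left_mono)
  then have "norm (\<Phi> s x - \<Phi> t x) \<le> L * norm (s - t)"
    using \<Phi>_deriv[OF assms]
    by (intro differentiable_bound[where S = UNIV and f' = "\<lambda>s h. h *\<^sub>R V (\<Phi> s x)"])
      (auto simp: has_vector_derivative_def)
  then show ?thesis by simp
qed

lemma \<Phi>_dist2:
  assumes "a \<in> X" "b \<in> X"
  shows "norm (\<Phi> s a - \<Phi> t b) \<le> norm (a - b) * exp ((L + 1) * \<bar>s\<bar>) + L * \<bar>s - t\<bar>"
  using \<Phi>_dist[OF assms, of s] \<Phi>_time_dist[OF assms(2), of s t]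
  by (smt (verit) norm_triangle_ineq add_diff_eq diff_add_cancel)

lemma \<Phi>_isCont: "x \<in> X \<Longrightarrow> isCont (\<lambda>t. \<Phi> t x) t"
  using \<Phi>_deriv has_vector_derivative_continuous by blast

lemma \<Phi>_near:
  assumes x: "x \<in> X" and "r > 0"
  obtains \<delta> where "\<delta> > 0" "\<And>s y. \<bar>s - T\<bar> < \<delta> \<Longrightarrow> y \<in> X \<Longrightarrow> dist y x < \<delta> \<Longrightarrow> dist (\<Phi> s y) (\<Phi> T x) < r"
proof -
  define c where "c = exp ((L + 1) * (\<bar>T\<bar> + 1)) + L"
  have c: "c > 0" unfolding c_def using L_pos by (simp add: add_pos_pos)
  define \<delta> where "\<delta> = min 1 (r / c)"
  have "dist (\<Phi> s y) (\<Phi> T x) < r" if s: "\<bar>s - T\<bar> < \<delta>" and y: "y \<in> X" "dist y x < \<delta>" for s y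
  proof -
    have "(L + 1) * \<bar>s\<bar> \<le> (L + 1) * (\<bar>T\<bar> + 1)"
      using s L_pos by (intro mult_left_mono) (auto simp: \<delta>_def)
    then have "norm (y - x) * exp ((L + 1) * \<bar>s\<bar>) \<le> norm (y - x) * exp ((L + 1) * (\<bar>T\<bar> + 1))"
      by (intro mult_left_mono) auto
    then have "dist (\<Phi> s y) (\<Phi> T x) \<le> norm (y - x) * exp ((L + 1) * (\<bar>T\<bar> + 1)) + L * \<bar>s - T\<bar>"
      using \<Phi>_dist2[OF y(1) x, of s T] by (simp add: dist_norm)
    also have "\<dots> < \<delta> * exp ((L + 1) * (\<bar>T\<bar> + 1)) + L * \<delta>"
      using s y L_pos by (intro add_strict_mono mult_strict_right_mono mult_strict_left_mono) (auto simp: dist_norm)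
    also have "\<dots> = \<delta> * c"
      by (simp add: c_def algebra_simps)
    also have "\<dots> \<le> r"
      using c by (simp add: \<delta>_def field_simps min_def)
    finally show ?thesis .
  qed
  moreover have "\<delta> > 0" using c \<open>r > 0\<close> by (simp add: \<delta>_def)
  ultimately show ?thesis using that by blast
qed

lemma continuous_on_\<Phi>: "continuous_on (UNIV \<times> X) (\<lambda>(t, x). \<Phi> t x)"
  unfolding continuous_on_iff
proof (intro ballI allI impI)
  fix p :: "real \<times> (real^2)" and e :: real assume p: "p \<in> UNIV \<times> X" and e: "e > 0"
  obtain \<delta> where \<delta>: "\<delta> > 0"
    "\<And>s y. \<bar>s - fst p\<bar> < \<delta> \<Longrightarrow> y \<in> X \<Longrightarrow> dist y (snd p) < \<delta> \<Longrightarrow> dist (\<Phi> s y) (\<Phi> (fst p) (snd p)) < e"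
    by (rule \<Phi>_near[of "snd p" e "fst p"]) (use p e in auto)
  show "\<exists>d>0. \<forall>q\<in>UNIV \<times> X. dist q p < d \<longrightarrow>
      dist (case q of (t, x) \<Rightarrow> \<Phi> t x) (case p of (t, x) \<Rightarrow> \<Phi> t x) < e"
  proof (intro exI[of _ \<delta>] conjI ballI impI \<delta>(1))
    fix q assume q: "q \<in> UNIV \<times> X" "dist q p < \<delta>"
    have "\<bar>fst q - fst p\<bar> < \<delta>" "dist (snd q) (snd p) < \<delta>"
      using q(2) dist_fst_le[of q p] dist_snd_le[of q p] by (auto simp: dist_real_def)
    then show "dist (case q of (t, x) \<Rightarrow> \<Phi> t x) (case p of (t, x) \<Rightarrow> \<Phi> t x) < e"
      using \<delta>(2)[of "fst q" "snd q"] q(1) by (auto simp: case_prod_beta)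
  qed
qed

lemma H_has_derivative: "(H has_derivative (\<lambda>h. h \<bullet> grad H x)) (at x)"
  using H_gradient[of x] by (simp add: gderiv_def)

lemma V_inner: "x \<in> X \<Longrightarrow> V x \<bullet> h = grad H x $ 2 * h $ 1 - grad H x $ 1 * h $ 2"
  by (simp add: V_eq inner_vec_def sum_2)

lemma H_invariant:
  assumes "x \<in> X"
  shows "H (\<Phi> t x) = H x"
proof -
  have "((\<lambda>s. H (\<Phi> s x)) has_derivative (\<lambda>h. 0)) (at s)" for s
    using has_derivative_compose[OF \<Phi>_deriv[OF assms, unfolded has_vector_derivative_def] H_has_derivative, of s]
      V_inner[of "\<Phi> s x" "grad H (\<Phi> s x)"] assms
    by (auto simp: o_def mult.commute)
  then have "H (\<Phi> t x) = H (\<Phi> 0 x)"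
    by (intro has_derivative_zero_unique[of UNIV "\<lambda>s. H (\<Phi> s x)"]) auto
  then show ?thesis using assms by simp
qed

lemma V_zero_fixed:
  assumes "x \<in> X" "V x = 0"
  shows "\<Phi> t x = x"
  using solution_unique[of "\<lambda>_. x" t] assms by auto

section \<open>Return times and the least period\<close>

lemma period_le: "t > 0 \<Longrightarrow> \<Phi> t x = x \<Longrightarrow> period \<Phi> x \<le> ereal t"
  unfolding period_def by (rule INF_lower) auto

lemma period_ge: "(\<And>t. t > 0 \<Longrightarrow> \<Phi> t x = x \<Longrightarrow> e \<le> t) \<Longrightarrow> ereal e \<le> period \<Phi> x"
  unfolding period_def by (rule INF_greatest) auto

lemma period_nonneg: "period \<Phi> x \<ge> 0"
  using period_ge[of x 0] by (auto simp: zero_ereal_def)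

lemma in_N_iff: "x \<in> N \<longleftrightarrow> x \<in> X \<and> period \<Phi> x \<noteq> 0 \<and> period \<Phi> x \<noteq> \<infinity>"
  by (auto simp: degenerate_set_def)

lemma period_eq: "x \<in> N \<Longrightarrow> period \<Phi> x = ereal (P x)"
  using period_nonneg[of x] unfolding in_N_iff P_def by (cases "period \<Phi> x") auto

lemma P_pos: "x \<in> N \<Longrightarrow> P x > 0"
  using period_nonneg[of x] period_eq[of x] unfolding in_N_iff P_def by (cases "period \<Phi> x") (auto simp: less_le)

lemma P_le: "x \<in> N \<Longrightarrow> t > 0 \<Longrightarrow> \<Phi> t x = x \<Longrightarrow> P x \<le> t"
  by (metis period_eq period_le ereal_less_eq(3))

lemma P_ge: "x \<in> N \<Longrightarrow> (\<And>t. t > 0 \<Longrightarrow> \<Phi> t x = x \<Longrightarrow> e \<le> t) \<Longrightarrow> e \<le> P x"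
  by (metis period_eq period_ge ereal_less_eq(3))

lemma P_min: "x \<in> N \<Longrightarrow> 0 < t \<Longrightarrow> t < P x \<Longrightarrow> \<Phi> t x \<noteq> x"
  using P_le[of x t] by auto

text \<open>If the orbit missed \<open>x\<close> at time \<open>P x\<close>, continuity would
  exclude returns throughout a window around \<open>P x\<close>, and \<open>P x + e\<close> would
  bound all return times from below.\<close>

lemma \<Phi>_P:
  assumes x: "x \<in> N"
  shows "\<Phi> (P x) x = x"
proof (rule ccontr)
  assume "\<Phi> (P x) x \<noteq> x"
  then have "\<forall>\<^sub>F t in at (P x). \<Phi> t x \<noteq> x"
    using tendsto_imp_eventually_ne[OF \<Phi>_isCont[unfolded isCont_def]] x by blast
  then obtain e where e: "e > 0" "\<And>t. t \<noteq> P x \<Longrightarrow> dist t (P x) < e \<Longrightarrow> \<Phi> t x \<noteq> x"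
    unfolding eventually_at by blast
  have "P x + e \<le> P x"
  proof (rule P_ge[OF x])
    fix t assume t: "t > 0" "\<Phi> t x = x"
    have "P x \<le> t"
      by (rule P_le[OF x t])
    moreover have "t \<noteq> P x" using t \<open>\<Phi> (P x) x \<noteq> x\<close> by auto
    moreover have "\<not> dist t (P x) < e"
      using e(2) t(2) \<open>t \<noteq> P x\<close> by blast
    ultimately show "P x + e \<le> t"
      by (simp add: dist_real_def)
  qed
  then show False using e(1) by auto
qed

lemma \<Phi>_nat_P: "x \<in> N \<Longrightarrow> \<Phi> (real n * P x) x = x"
proof (induction n)
  case (Suc n)
  then show ?case
    using \<Phi>_add[of x "real n * P x" "P x"] \<Phi>_P by (auto simp: algebra_simps)
qed auto

lemma \<Phi>_int_P: "x \<in> N \<Longrightarrow> \<Phi> (of_int k * P x) x = x"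
proof (cases k)
  case (neg n)
  assume x: "x \<in> N"
  have "of_int k * P x = - (real (Suc n) * P x)" unfolding neg by (simp add: algebra_simps)
  then show ?thesis
    using \<Phi>_nat_P[OF x, of "Suc n"] \<Phi>_minus(1)[of x "real (Suc n) * P x"] x by auto
qed (use \<Phi>_nat_P in auto)

lemma \<Phi>_mod_P: "x \<in> N \<Longrightarrow> \<Phi> (t + of_int k * P x) x = \<Phi> t x"
  using \<Phi>_add[of x t "of_int k * P x"] \<Phi>_int_P by auto

lemma time_mod_P:
  assumes "x \<in> N"
  obtains k :: int where "0 \<le> t - of_int k * P x" "t - of_int k * P x < P x"
proof (rule that[of "\<lfloor>t / P x\<rfloor>"])
  have p: "P x > 0" using P_pos assms by blast
  show "0 \<le> t - of_int \<lfloor>t / P x\<rfloor> * P x"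
    using p by (simp add: pos_le_divide_eq[symmetric])
  have "t / P x < of_int \<lfloor>t / P x\<rfloor> + 1" by linarith
  then show "t - of_int \<lfloor>t / P x\<rfloor> * P x < P x"
    using p by (simp add: pos_divide_less_eq algebra_simps)
qed

lemma N_V_nonzero:
  assumes "x \<in> N"
  shows "V x \<noteq> 0"
proof
  assume "V x = 0"
  then have "\<Phi> (P x / 2) x = x"
    using V_zero_fixed assms by blast
  then show False using P_min[OF assms, of "P x / 2"] P_pos[OF assms] by auto
qed

lemma period_invariant:
  assumes "x \<in> X"
  shows "period \<Phi> (\<Phi> t x) = period \<Phi> x"
proof -
  have "\<Phi> s (\<Phi> t x) = \<Phi> t x \<longleftrightarrow> \<Phi> s x = x" for s
    using \<Phi>_add[OF assms, of s t] \<Phi>_add[OF assms, of t s] \<Phi>_inj[of "\<Phi> s x" x t] assms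
    by (auto simp: add.commute)
  then show ?thesis by (simp add: period_def)
qed

lemma P_invariant: "x \<in> X \<Longrightarrow> P (\<Phi> t x) = P x"
  by (simp add: P_def period_invariant)

lemma \<Phi>_in_N: "x \<in> N \<Longrightarrow> \<Phi> t x \<in> N"
  unfolding in_N_iff using period_invariant by auto

end

section \<open>Periods of nearby points\<close>

context hamiltonian_flow
begin

text \<open>With \<open>T = 0\<close> and \<open>T = P x\<close> this says that the displacement
  along \<open>V x\<close> has slope close to \<open>V x \<bullet> V x\<close> near the start and
  near the return. In the radius \<open>\<epsilon> / L\<^sup>2\<close>, one factor \<open>L\<close>
  bounds \<open>norm (V x)\<close> and one is the Lipschitz constant.\<close>

lemma velocity_near:
  assumes x: "x \<in> X" "\<Phi> T x = x" and "\<epsilon> > 0"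
  obtains \<delta> where "\<delta> > 0"
    "\<And>s y. \<bar>s - T\<bar> < \<delta> \<Longrightarrow> y \<in> X \<Longrightarrow> dist y x < \<delta> \<Longrightarrow>
      dist (\<Phi> s y) x < \<epsilon> \<and> \<bar>V x \<bullet> V (\<Phi> s y) - V x \<bullet> V x\<bar> < \<epsilon>"
proof -
  have "min \<epsilon> (\<epsilon> / L\<^sup>2) > 0"
    using \<open>\<epsilon> > 0\<close> L_pos by simp
  then obtain \<delta> where \<delta>: "\<delta> > 0"
    "\<And>s y. \<bar>s - T\<bar> < \<delta> \<Longrightarrow> y \<in> X \<Longrightarrow> dist y x < \<delta> \<Longrightarrow> dist (\<Phi> s y) x < min \<epsilon> (\<epsilon> / L\<^sup>2)"
    using \<Phi>_near[OF x(1), of "min \<epsilon> (\<epsilon> / L\<^sup>2)" T] unfolding x(2) by metis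
  have "\<bar>V x \<bullet> V z - V x \<bullet> V x\<bar> < \<epsilon>" if z: "z \<in> X" "dist z x < \<epsilon> / L\<^sup>2" for z
  proof -
    have "\<bar>V x \<bullet> V z - V x \<bullet> V x\<bar> \<le> norm (V x) * norm (V z - V x)"
      by (metis Cauchy_Schwarz_ineq2 inner_diff_right)
    also have "\<dots> \<le> L * (L * norm (z - x))"
      using V_bound V_lip x(1) z(1) L_pos by (intro mult_mono) auto
    also have "\<dots> < \<epsilon>"
      using z(2) L_pos by (simp add: dist_norm pos_less_divide_eq power2_eq_square mult_ac)
    finally show ?thesis .
  qed
  then show ?thesis
    using \<delta> that[of \<delta>] by (meson \<Phi>_in min_less_iff_conj)
qed

text \<open>A vector-valued path has no exact mean value theorem, so the displacement is projected
  on a fixed direction \<open>v\<close>.\<close>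

lemma displacement_mvt:
  assumes y: "y \<in> X" and "s < t"
  obtains \<xi> where "s < \<xi>" "\<xi> < t" "v \<bullet> (\<Phi> t y - \<Phi> s y) = (t - s) * (v \<bullet> V (\<Phi> \<xi> y))"
proof -
  have "((\<lambda>r. v \<bullet> \<Phi> r y) has_real_derivative v \<bullet> V (\<Phi> r y)) (at r)" for r
    using bounded_linear.has_vector_derivative[OF bounded_linear_inner_right \<Phi>_deriv[OF y]]
    by (simp add: has_real_derivative_iff_has_vector_derivative)
  then show ?thesis
    using MVT2[OF \<open>s < t\<close>, of "\<lambda>r. v \<bullet> \<Phi> r y" "\<lambda>r. v \<bullet> V (\<Phi> r y)"] that
    by (auto simp: inner_diff_right)
qed

text \<open>\<open>H\<close> is strictly monotone along the line through \<open>x\<close> orthogonal to \<open>V x\<close>, and a return to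
  that line stays on the same level of \<open>H\<close>, so it closes the orbit.\<close>

lemma level_line:
  assumes x: "x \<in> X" "V x \<noteq> 0"
  obtains r where "r > 0"
    "\<And>a b. dist a x < r \<Longrightarrow> dist b x < r \<Longrightarrow> V x \<bullet> (a - b) = 0 \<Longrightarrow> H a = H b \<Longrightarrow> a = b"
proof -
  let ?G = "grad H"
  have G: "?G x \<noteq> 0"
    using x V_eq[of x] by (auto simp: vec_eq_iff forall_2)
  have "isCont ?G x"
    using H_gradient_cont continuous_on_eq_continuous_at by blast
  moreover have "norm (?G x) > 0" using G by simp
  ultimately obtain r where r: "r > 0" "\<And>z. dist z x < r \<Longrightarrow> dist (?G z) (?G x) < norm (?G x)"
    unfolding continuous_at_eps_delta by meson
  have pos: "?G x \<bullet> ?G z > 0" if "dist z x < r" for z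
  proof -
    have "\<bar>?G x \<bullet> (?G z - ?G x)\<bar> \<le> norm (?G x) * norm (?G z - ?G x)"
      by (rule Cauchy_Schwarz_ineq2)
    also have "\<dots> < norm (?G x) * norm (?G x)"
      using r(2)[OF that] G by (intro mult_strict_left_mono) (auto simp: dist_norm)
    also have "\<dots> = ?G x \<bullet> ?G x"
      by (simp add: power2_norm_eq_inner[symmetric] power2_eq_square)
    finally show ?thesis by (simp add: inner_diff_right)
  qed
  show ?thesis
  proof (rule that[OF r(1)])
    fix a b assume ab: "dist a x < r" "dist b x < r" "V x \<bullet> (a - b) = 0" "H a = H b"
    define c where "c = ((a - b) \<bullet> ?G x) / (?G x \<bullet> ?G x)"
    have perp: "?G x $ 2 * (a - b) $ 1 = ?G x $ 1 * (a - b) $ 2"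
      using V_inner[OF x(1), of "a - b"] ab(3) by simp
    have GG: "?G x \<bullet> ?G x \<noteq> 0" using G by simp
    \<comment> \<open>In the plane a vector orthogonal to \<open>V x\<close>, the quarter turn of
      \<open>grad H x\<close>, is a multiple of \<open>grad H x\<close>; denominators are cleared to
      keep the identity polynomial.\<close>
    have "(?G x \<bullet> ?G x) *\<^sub>R (a - b) = ((a - b) \<bullet> ?G x) *\<^sub>R ?G x"
    proof -
      have "(g1 * g1 + g2 * g2) * h1 = (h1 * g1 + h2 * g2) * g1"
        "(g1 * g1 + g2 * g2) * h2 = (h1 * g1 + h2 * g2) * g2"
        if "g2 * h1 = g1 * h2" for g1 g2 h1 h2 :: real
        using that by algebra+
      then show ?thesis
        using perp unfolding vec_eq_iff forall_2 inner_vec_def sum_2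
        by (simp only: vector_scaleR_component inner_real_def real_scaleR_def)
    qed
    then have "inverse (?G x \<bullet> ?G x) *\<^sub>R (?G x \<bullet> ?G x) *\<^sub>R (a - b) =
        inverse (?G x \<bullet> ?G x) *\<^sub>R ((a - b) \<bullet> ?G x) *\<^sub>R ?G x"
      by (rule arg_cong)
    then have c: "a - b = c *\<^sub>R ?G x"
      using GG by (simp add: c_def divide_inverse mult.commute)
    have "((\<lambda>s. H (b + s *\<^sub>R (a - b))) has_real_derivative (a - b) \<bullet> ?G (b + s *\<^sub>R (a - b))) (at s)" for s
    proof -
      have "((\<lambda>s. b + s *\<^sub>R (a - b)) has_derivative (\<lambda>h. h *\<^sub>R (a - b))) (at s)"
        by (auto intro!: derivative_eq_intros)
      from has_derivative_compose[OF this H_has_derivative] show ?thesis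
        by (rule has_derivative_imp_has_field_derivative) simp
    qed
    then obtain s where s: "0 < s" "s < 1" and eq: "H a - H b = (a - b) \<bullet> ?G (b + s *\<^sub>R (a - b))"
      using MVT2[of 0 1 "\<lambda>s. H (b + s *\<^sub>R (a - b))" "\<lambda>s. (a - b) \<bullet> ?G (b + s *\<^sub>R (a - b))"] by auto
    have "b + s *\<^sub>R (a - b) \<in> ball x r"
      using convexD_alt[OF convex_ball, of b x r a s] ab s by (simp add: algebra_simps dist_commute)
    then have "?G x \<bullet> ?G (b + s *\<^sub>R (a - b)) > 0"
      by (intro pos) (simp add: dist_commute)
    moreover have "c * (?G x \<bullet> ?G (b + s *\<^sub>R (a - b))) = 0"
      using eq ab(4) c by simp
    ultimately show "a = b" using c by simp
  qed
qed

text \<open>Existence of a period near \<open>P x\<close> is the intermediate value theorem for the displacement along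
  \<open>V x\<close>; shorter periods are excluded by compactness of the remaining time interval.\<close>

lemma P_near:
  assumes x: "x \<in> N" and "\<eta> > 0"
  obtains \<delta> where "\<delta> > 0" "\<And>y. y \<in> X \<Longrightarrow> dist y x < \<delta> \<Longrightarrow> y \<in> N \<and> \<bar>P y - P x\<bar> < \<eta>"
proof -
  have xX: "x \<in> X" using x by simp
  have Vx: "V x \<noteq> 0" using N_V_nonzero[OF x] .
  define a where "a = V x \<bullet> V x"
  have a: "a > 0" using Vx by (simp add: a_def)
  have p: "P x > 0" by (rule P_pos[OF x])
  obtain r where r: "r > 0"
    "\<And>a b. dist a x < r \<Longrightarrow> dist b x < r \<Longrightarrow> V x \<bullet> (a - b) = 0 \<Longrightarrow> H a = H b \<Longrightarrow> a = b"
    by (rule level_line[OF xX Vx]) blast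
  have e0: "min r (a / 2) > 0" using r a by simp
  obtain \<delta>1 where \<delta>1: "\<delta>1 > 0" "\<And>s y. \<bar>s - 0\<bar> < \<delta>1 \<Longrightarrow> y \<in> X \<Longrightarrow> dist y x < \<delta>1 \<Longrightarrow>
      dist (\<Phi> s y) x < min r (a / 2) \<and> \<bar>V x \<bullet> V (\<Phi> s y) - V x \<bullet> V x\<bar> < min r (a / 2)"
    by (rule velocity_near[OF xX \<Phi>_0[OF xX] e0]) blast
  obtain \<delta>2 where \<delta>2: "\<delta>2 > 0" "\<And>s y. \<bar>s - P x\<bar> < \<delta>2 \<Longrightarrow> y \<in> X \<Longrightarrow> dist y x < \<delta>2 \<Longrightarrow>
      dist (\<Phi> s y) x < min r (a / 2) \<and> \<bar>V x \<bullet> V (\<Phi> s y) - V x \<bullet> V x\<bar> < min r (a / 2)"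
    by (rule velocity_near[OF xX \<Phi>_P[OF x] e0]) blast
  define e where "e = Min {\<eta>, \<delta>1, \<delta>2, P x} / 2"
  have e: "e > 0" "e < \<eta>" "e < \<delta>1" "e < \<delta>2" "e < P x"
    using \<open>\<eta> > 0\<close> \<delta>1(1) \<delta>2(1) p by (auto simp: e_def)
  define B where "B = exp ((L + 1) * P x) + 1"
  have B: "B > 0" unfolding B_def by (simp add: add_pos_pos)
  have return: "norm (\<Phi> (P x) y - y) \<le> B * norm (y - x)" if "y \<in> X" for y
  proof -
    have "norm (\<Phi> (P x) y - y) = norm ((\<Phi> (P x) y - \<Phi> (P x) x) - (y - x))"
      using \<Phi>_P[OF x] by simp
    also have "\<dots> \<le> norm (\<Phi> (P x) y - \<Phi> (P x) x) + norm (y - x)"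
      by (rule norm_triangle_ineq4)
    also have "\<dots> \<le> B * norm (y - x)"
      using \<Phi>_dist[OF that xX, of "P x"] p by (simp add: B_def algebra_simps)
    finally show ?thesis .
  qed
  \<comment> \<open>Times at which a premature return is excluded by distance: the orbit of
    \<open>x\<close> itself keeps a positive distance \<open>\<mu>\<close> from \<open>x\<close>
    there. If the window is empty, \<open>\<mu> = 1\<close> is a dummy.\<close>
  define I where "I = {e..P x - e}"
  obtain \<mu> where \<mu>: "\<mu> > 0" "\<And>t. t \<in> I \<Longrightarrow> norm (\<Phi> t x - x) \<ge> \<mu>"
  proof (cases "I = {}")
    case False
    have "continuous_on I (\<lambda>t. norm (\<Phi> t x - x))"
      using \<Phi>_isCont[OF xX] by (intro continuous_intros continuous_at_imp_continuous_on) auto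
    then obtain t0 where t0: "t0 \<in> I" "\<And>t. t \<in> I \<Longrightarrow> norm (\<Phi> t0 x - x) \<le> norm (\<Phi> t x - x)"
      using continuous_attains_inf[of I "\<lambda>t. norm (\<Phi> t x - x)"] False by (auto simp: I_def)
    have "\<Phi> t0 x \<noteq> x" using P_min[OF x, of t0] t0(1) e by (auto simp: I_def)
    then show ?thesis using that[of "norm (\<Phi> t0 x - x)"] t0(2) by auto
  qed (use that[of 1] in auto)
  \<comment> \<open>The fourth bound makes the displacement at time \<open>P x\<close> smaller than
    the amount \<open>e * (a / 2)\<close> gained or lost within time \<open>e\<close>; the fifth
    keeps the orbit of \<open>y\<close> from closing during \<open>I\<close>.\<close>
  define \<delta> where "\<delta> = Min {\<delta>1, \<delta>2, r, e * a / (2 * B * norm (V x)), \<mu> / B}"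
  have \<delta>: "\<delta> > 0"
    unfolding \<delta>_def using \<delta>1(1) \<delta>2(1) r(1) e a B \<mu>(1) Vx by simp
  have "y \<in> N \<and> \<bar>P y - P x\<bar> < \<eta>" if y: "y \<in> X" "dist y x < \<delta>" for y
  proof -
    have yl: "dist y x < \<delta>1" "dist y x < \<delta>2" "dist y x < r"
      "dist y x < e * a / (2 * B * norm (V x))" "dist y x < \<mu> / B"
      using y(2) unfolding \<delta>_def by simp_all
    have speed1: "V x \<bullet> V (\<Phi> s y) > a / 2" if "\<bar>s\<bar> < \<delta>1" for s
    proof -
      have "\<bar>V x \<bullet> V (\<Phi> s y) - a\<bar> < a / 2"
        using \<delta>1(2)[of s y] that y yl unfolding a_def by simp
      then show ?thesis by linarith
    qed
    have speed2: "V x \<bullet> V (\<Phi> s y) > a / 2" if "\<bar>s - P x\<bar> < \<delta>2" for s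
    proof -
      have "\<bar>V x \<bullet> V (\<Phi> s y) - a\<bar> < a / 2"
        using \<delta>2(2)[of s y] that y yl unfolding a_def by simp
      then show ?thesis by linarith
    qed
    define g where "g t = V x \<bullet> (\<Phi> t y - y)" for t
    have "\<bar>g (P x)\<bar> \<le> norm (V x) * norm (\<Phi> (P x) y - y)"
      unfolding g_def by (rule Cauchy_Schwarz_ineq2)
    also have "\<dots> \<le> norm (V x) * (B * dist y x)"
      using return[OF y(1)] by (intro mult_left_mono) (auto simp: dist_norm)
    also have "\<dots> < e * (a / 2)"
      using yl(4) B Vx by (simp add: field_simps)
    finally have gP: "\<bar>g (P x)\<bar> < e * (a / 2)" .
    have "g (P x + e) - g (P x) \<ge> e * (a / 2)"
    proof -
      obtain \<xi> where \<xi>: "P x < \<xi>" "\<xi> < P x + e"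
        and eq: "V x \<bullet> (\<Phi> (P x + e) y - \<Phi> (P x) y) = (P x + e - P x) * (V x \<bullet> V (\<Phi> \<xi> y))"
        by (rule displacement_mvt[OF y(1), of "P x" "P x + e"]) (use e in auto)
      have "e * (a / 2) \<le> e * (V x \<bullet> V (\<Phi> \<xi> y))"
        using speed2[of \<xi>] \<xi> e by (intro mult_left_mono) auto
      then show ?thesis using eq by (simp add: g_def inner_diff_right)
    qed
    then have gp: "g (P x + e) > 0" using gP by linarith
    have "g (P x) - g (P x - e) \<ge> e * (a / 2)"
    proof -
      obtain \<xi> where \<xi>: "P x - e < \<xi>" "\<xi> < P x"
        and eq: "V x \<bullet> (\<Phi> (P x) y - \<Phi> (P x - e) y) = (P x - (P x - e)) * (V x \<bullet> V (\<Phi> \<xi> y))"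
        by (rule displacement_mvt[OF y(1), of "P x - e" "P x"]) (use e in auto)
      have "e * (a / 2) \<le> e * (V x \<bullet> V (\<Phi> \<xi> y))"
        using speed2[of \<xi>] \<xi> e by (intro mult_left_mono) auto
      then show ?thesis using eq by (simp add: g_def inner_diff_right)
    qed
    then have gm: "g (P x - e) < 0" using gP by linarith
    have "continuous_on {P x - e..P x + e} g"
      unfolding g_def using \<Phi>_isCont[OF y(1)]
      by (intro continuous_intros continuous_at_imp_continuous_on) auto
    then obtain t where t: "P x - e \<le> t" "t \<le> P x + e" "g t = 0"
      using IVT'[of g "P x - e" 0 "P x + e"] gp gm e by auto
    have ty: "\<Phi> t y = y"
    proof (rule r(2))
      show "dist (\<Phi> t y) x < r" using \<delta>2(2)[of t y] t y yl e by auto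
      show "V x \<bullet> (\<Phi> t y - y) = 0" using t(3) by (simp add: g_def)
    qed (use yl H_invariant y in auto)
    have tpos: "t > 0" using t e by linarith
    \<comment> \<open>Before time \<open>e\<close> the displacement along \<open>V x\<close> is
      strictly positive; between \<open>e\<close> and \<open>P x - e\<close> the distance
      \<open>\<mu>\<close> of \<open>\<Phi> s x\<close> from \<open>x\<close> exceeds the total
      error \<open>B * dist y x\<close>.\<close>
    have short: "P x - e \<le> s" if s: "s > 0" "\<Phi> s y = y" for s
    proof (rule ccontr)
      assume c: "\<not> P x - e \<le> s"
      show False
      proof (cases "s < e")
        case True
        obtain \<xi> where \<xi>: "0 < \<xi>" "\<xi> < s"
          and eq: "V x \<bullet> (\<Phi> s y - \<Phi> 0 y) = (s - 0) * (V x \<bullet> V (\<Phi> \<xi> y))"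
          by (rule displacement_mvt[OF y(1) s(1)])
        have "V x \<bullet> V (\<Phi> \<xi> y) > 0"
          using speed1[of \<xi>] \<xi> True e a by auto
        then show False using eq s y by simp
      next
        case False
        then have "s \<in> I" using c by (auto simp: I_def)
        then have "\<mu> \<le> norm (\<Phi> s x - x)" by (rule \<mu>(2))
        also have "\<Phi> s x - x = (y - x) - (\<Phi> s y - \<Phi> s x)" using s by simp
        also have "norm \<dots> \<le> norm (y - x) + norm (\<Phi> s y - \<Phi> s x)"
          by (rule norm_triangle_ineq4)
        also have "\<dots> \<le> norm (y - x) + norm (y - x) * exp ((L + 1) * P x)"
        proof -
          have "norm (y - x) * exp ((L + 1) * \<bar>s\<bar>) \<le> norm (y - x) * exp ((L + 1) * P x)"
            using s c e L_pos by (intro mult_left_mono) auto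
          then show ?thesis using \<Phi>_dist[OF y(1) xX, of s] by linarith
        qed
        also have "\<dots> = B * dist y x"
          by (simp add: B_def dist_norm algebra_simps)
        also have "\<dots> < \<mu>"
          using yl(5) B by (simp add: field_simps)
        finally show False by simp
      qed
    qed
    have le: "period \<Phi> y \<le> ereal t" using period_le[OF tpos ty] .
    have ge: "ereal (P x - e) \<le> period \<Phi> y" using short by (rule period_ge)
    have "y \<in> N"
      unfolding in_N_iff using le ge y(1) e(5) by (auto simp: zero_ereal_def)
    moreover have "P y \<le> t" "P x - e \<le> P y"
      using P_le[OF \<open>y \<in> N\<close> tpos ty] P_ge[OF \<open>y \<in> N\<close>] short by auto
    ultimately show ?thesis using t e by auto
  qed
  then show ?thesis using \<delta> that by blast
qed

end

section \<open>Differentiability of the period\<close>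

lemma grad_eqI:
  assumes "GDERIV f x :> D"
  shows "grad f x = D"
  unfolding grad_def
proof (rule the_equality)
  fix D' assume "GDERIV f x :> D'"
  then have "(\<lambda>h. h \<bullet> D') = (\<lambda>h. h \<bullet> D)"
    using assms has_derivative_unique unfolding gderiv_def by blast
  then have "(D' - D) \<bullet> D' = (D' - D) \<bullet> D" by metis
  then have "(D' - D) \<bullet> (D' - D) = 0" by (simp add: inner_diff_right)
  then show "D' = D" by simp
qed fact

text \<open>\<open>adjoint D 1\<close> is the Riesz representative of the functional
  \<open>D\<close>.\<close>

lemma GDERIV_grad:
  fixes f :: "'a::euclidean_space \<Rightarrow> real"
  assumes "(f has_derivative D) (at x)"
  shows "GDERIV f x :> grad f x"
proof -
  have "D = (\<lambda>h. h \<bullet> adjoint D 1)"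
    using adjoint_works[OF has_derivative_linear[OF assms], of _ 1] by simp
  then have "GDERIV f x :> adjoint D 1"
    using assms by (simp add: gderiv_def)
  then show ?thesis using grad_eqI by fastforce
qed

context hamiltonian_flow
begin

text \<open>Both orbits close, so the right side equals
  \<open>V x \<bullet> (\<Phi> (P b) b - \<Phi> (P a) b)\<close>, a displacement of \<open>b\<close>
  between two times, and the mean value theorem in time produces \<open>q\<close>. This takes the
  place of the implicit function theorem: bounding \<open>q\<close> away from 0 gives the Lipschitz
  estimate, letting \<open>q\<close> tend to \<open>V x \<bullet> V x\<close> gives the
  derivative.\<close>

lemma period_difference:
  assumes x: "x \<in> N" and "\<epsilon> > 0"
  obtains \<delta> where "\<delta> > 0"
    "\<And>a b. a \<in> X \<Longrightarrow> b \<in> X \<Longrightarrow> dist a x < \<delta> \<Longrightarrow> dist b x < \<delta> \<Longrightarrow>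
      \<exists>q. \<bar>q - V x \<bullet> V x\<bar> < \<epsilon> \<and> (P b - P a) * q = V x \<bullet> ((b - a) - (\<Phi> (P a) b - \<Phi> (P a) a))"
proof -
  have xX: "x \<in> X" using x by simp
  obtain \<delta>1 where \<delta>1: "\<delta>1 > 0" "\<And>s y. \<bar>s - P x\<bar> < \<delta>1 \<Longrightarrow> y \<in> X \<Longrightarrow> dist y x < \<delta>1 \<Longrightarrow>
      dist (\<Phi> s y) x < \<epsilon> \<and> \<bar>V x \<bullet> V (\<Phi> s y) - V x \<bullet> V x\<bar> < \<epsilon>"
    by (rule velocity_near[OF xX \<Phi>_P[OF x] \<open>\<epsilon> > 0\<close>]) blast
  obtain \<delta>2 where \<delta>2: "\<delta>2 > 0" "\<And>y. y \<in> X \<Longrightarrow> dist y x < \<delta>2 \<Longrightarrow> y \<in> N \<and> \<bar>P y - P x\<bar> < \<delta>1"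
    by (rule P_near[OF x \<delta>1(1)]) blast
  have "\<exists>q. \<bar>q - V x \<bullet> V x\<bar> < \<epsilon> \<and> (P b - P a) * q = V x \<bullet> ((b - a) - (\<Phi> (P a) b - \<Phi> (P a) a))"
    if ab: "a \<in> X" "b \<in> X" "dist a x < min \<delta>1 \<delta>2" "dist b x < min \<delta>1 \<delta>2" for a b
  proof -
    have a: "a \<in> N" "\<bar>P a - P x\<bar> < \<delta>1" and b: "b \<in> N" "\<bar>P b - P x\<bar> < \<delta>1"
      using \<delta>2(2) ab by auto
    have q: "\<bar>V x \<bullet> V (\<Phi> \<xi> b) - V x \<bullet> V x\<bar> < \<epsilon>" if "\<bar>\<xi> - P x\<bar> < \<delta>1" for \<xi>
      using \<delta>1(2)[of \<xi> b] that ab by auto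
    have rhs: "V x \<bullet> ((b - a) - (\<Phi> (P a) b - \<Phi> (P a) a)) = V x \<bullet> (\<Phi> (P b) b - \<Phi> (P a) b)"
      using \<Phi>_P[OF a(1)] \<Phi>_P[OF b(1)] by (simp add: algebra_simps)
    show ?thesis
    proof (cases "P a" "P b" rule: linorder_cases)
      case less
      obtain \<xi> where \<xi>: "P a < \<xi>" "\<xi> < P b"
        and eq: "V x \<bullet> (\<Phi> (P b) b - \<Phi> (P a) b) = (P b - P a) * (V x \<bullet> V (\<Phi> \<xi> b))"
        by (rule displacement_mvt[OF ab(2) less])
      show ?thesis
        using eq rhs q[of \<xi>] \<xi> a b by (intro exI[of _ "V x \<bullet> V (\<Phi> \<xi> b)"]) auto
    next
      \<comment> \<open>Both sides vanish, so any \<open>q\<close> within the tolerance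
        serves.\<close>
      case equal
      then show ?thesis
        using rhs \<open>\<epsilon> > 0\<close> by (intro exI[of _ "V x \<bullet> V x"]) auto
    next
      case greater
      obtain \<xi> where \<xi>: "P b < \<xi>" "\<xi> < P a"
        and eq: "V x \<bullet> (\<Phi> (P a) b - \<Phi> (P b) b) = (P a - P b) * (V x \<bullet> V (\<Phi> \<xi> b))"
        by (rule displacement_mvt[OF ab(2) greater])
      have "(P b - P a) * (V x \<bullet> V (\<Phi> \<xi> b)) = V x \<bullet> (\<Phi> (P b) b - \<Phi> (P a) b)"
        using eq by (simp add: algebra_simps)
      then show ?thesis
        using rhs q[of \<xi>] \<xi> a b by (intro exI[of _ "V x \<bullet> V (\<Phi> \<xi> b)"]) auto
    qed
  qed
  then show ?thesis
    using that[of "min \<delta>1 \<delta>2"] \<delta>1(1) \<delta>2(1) by simp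
qed

lemma return_displacement:
  assumes "a \<in> X" "b \<in> X" "\<bar>t\<bar> \<le> T"
  shows "\<bar>V x \<bullet> ((b - a) - (\<Phi> t b - \<Phi> t a))\<bar> \<le> norm (V x) * (1 + exp ((L + 1) * T)) * norm (b - a)"
proof -
  have "norm ((b - a) - (\<Phi> t b - \<Phi> t a)) \<le> norm (b - a) + norm (\<Phi> t b - \<Phi> t a)"
    by (rule norm_triangle_ineq4)
  also have "norm (\<Phi> t b - \<Phi> t a) \<le> norm (b - a) * exp ((L + 1) * \<bar>t\<bar>)"
    using assms by (intro \<Phi>_dist)
  also have "\<dots> \<le> norm (b - a) * exp ((L + 1) * T)"
    using assms L_pos by (intro mult_left_mono) auto
  finally have *: "norm ((b - a) - (\<Phi> t b - \<Phi> t a)) \<le> (1 + exp ((L + 1) * T)) * norm (b - a)"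
    by (simp add: algebra_simps)
  have "\<bar>V x \<bullet> ((b - a) - (\<Phi> t b - \<Phi> t a))\<bar> \<le> norm (V x) * norm ((b - a) - (\<Phi> t b - \<Phi> t a))"
    by (rule Cauchy_Schwarz_ineq2)
  also have "\<dots> \<le> norm (V x) * ((1 + exp ((L + 1) * T)) * norm (b - a))"
    by (rule mult_left_mono[OF *]) simp
  finally show ?thesis by (simp add: mult.assoc)
qed

text \<open>With tolerance \<open>a0 / 2\<close> the factor \<open>q\<close> is at least
  \<open>a0 / 2\<close> and can be divided out; \<open>P a \<le> P x + 1\<close> bounds the time
  over which the two orbits separate.\<close>

lemma P_locally_lipschitz:
  assumes x: "x \<in> N"
  obtains u C where "u > 0" "C-lipschitz_on (cball x u \<inter> X) P"
proof -
  define a0 where "a0 = V x \<bullet> V x"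
  have a0: "a0 > 0" using N_V_nonzero[OF x] by (simp add: a0_def)
  then have "a0 / 2 > 0" by simp
  then obtain \<delta>1 where \<delta>1: "\<delta>1 > 0"
    "\<And>a b. a \<in> X \<Longrightarrow> b \<in> X \<Longrightarrow> dist a x < \<delta>1 \<Longrightarrow> dist b x < \<delta>1 \<Longrightarrow>
      \<exists>q. \<bar>q - V x \<bullet> V x\<bar> < a0 / 2 \<and> (P b - P a) * q = V x \<bullet> ((b - a) - (\<Phi> (P a) b - \<Phi> (P a) a))"
    by (rule period_difference[OF x]) blast
  obtain \<delta>2 where \<delta>2: "\<delta>2 > 0" "\<And>y. y \<in> X \<Longrightarrow> dist y x < \<delta>2 \<Longrightarrow> y \<in> N \<and> \<bar>P y - P x\<bar> < 1"
    by (rule P_near[OF x zero_less_one]) blast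
  define B where "B = norm (V x) * (1 + exp ((L + 1) * (P x + 1)))"
  define C where "C = 2 * B / a0"
  have "B \<ge> 0" by (simp add: B_def add_nonneg_nonneg)
  then have C: "C \<ge> 0" using a0 by (simp add: C_def)
  have "C-lipschitz_on (cball x (min \<delta>1 \<delta>2 / 2) \<inter> X) P"
  proof (rule lipschitz_onI[OF _ C])
    fix a b assume ab: "a \<in> cball x (min \<delta>1 \<delta>2 / 2) \<inter> X" "b \<in> cball x (min \<delta>1 \<delta>2 / 2) \<inter> X"
    then have d: "dist a x < \<delta>1" "dist b x < \<delta>1" "dist a x < \<delta>2"
      using \<delta>1(1) \<delta>2(1) by (auto simp: dist_commute min_def split: if_splits)
    obtain q where q: "\<bar>q - a0\<bar> < a0 / 2"
      "(P b - P a) * q = V x \<bullet> ((b - a) - (\<Phi> (P a) b - \<Phi> (P a) a))"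
      using \<delta>1(2)[OF _ _ d(1,2)] ab unfolding a0_def by auto
    have Pa: "\<bar>P a\<bar> \<le> P x + 1"
      using \<delta>2(2)[of a] P_pos[of a] d ab by (auto simp: abs_le_iff)
    have "\<bar>P b - P a\<bar> * (a0 / 2) \<le> \<bar>P b - P a\<bar> * \<bar>q\<bar>"
      using q(1) by (intro mult_left_mono) (auto simp: abs_if split: if_splits)
    also have "\<dots> = \<bar>V x \<bullet> ((b - a) - (\<Phi> (P a) b - \<Phi> (P a) a))\<bar>"
      by (simp add: q(2)[symmetric] abs_mult)
    also have "\<dots> \<le> B * norm (b - a)"
      unfolding B_def using return_displacement Pa ab by blast
    finally show "dist (P a) (P b) \<le> C * dist a b"
      using a0 by (simp add: C_def dist_real_def dist_norm norm_minus_commute abs_minus_commute field_simps)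
  qed
  then show ?thesis using that[of "min \<delta>1 \<delta>2 / 2" C] \<delta>1(1) \<delta>2(1) by simp
qed

text \<open>Each difference \<open>w h\<close> solves the linearised equation along the orbit of
  \<open>x\<close> up to an error proportional to \<open>norm h\<close>. A combination with
  vanishing initial value therefore stays small by Gronwall, which is the almost-linearity required;
  no solution of the linearised equation has to be constructed.\<close>

lemma \<Phi>_differentiable:
  assumes x: "x \<in> \<Omega>"
  shows "\<exists>D. (\<Phi> T has_derivative D) (at x)"
proof (rule has_derivative_if_almost_linear)
  fix \<epsilon> :: real assume "\<epsilon> > 0"
  define E where "E = exp ((L + 1) * \<bar>T\<bar>)"
  have E: "E > 0" by (simp add: E_def)
  have xX: "x \<in> X" using x closure_subset by blast
  \<comment> \<open>One factor \<open>E\<close> pays for the growth of \<open>w h\<close> up to time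
    \<open>T\<close>, the other for the final Gronwall estimate.\<close>
  have "\<epsilon> / (E * E) > 0" using \<open>\<epsilon> > 0\<close> E by simp
  then obtain \<delta>0 where \<delta>0: "\<delta>0 > 0" "\<And>a b. a \<in> X \<Longrightarrow> b \<in> X \<Longrightarrow> dist a b < \<delta>0 \<Longrightarrow>
      norm (V b - V a - blinfun_apply (V' a) (b - a)) \<le> \<epsilon> / (E * E) * norm (b - a)"
    using V_differentiable by meson
  obtain r where r: "r > 0" "ball x r \<subseteq> \<Omega>"
    using open_domain x openE by blast
  define \<delta> where "\<delta> = min r (\<delta>0 / E)"
  show "\<exists>\<delta>>0. \<forall>h1 h2 h3 c1 c2 c3.
      norm h1 < \<delta> \<and> norm h2 < \<delta> \<and> norm h3 < \<delta> \<and> c1 *\<^sub>R h1 + c2 *\<^sub>R h2 + c3 *\<^sub>R h3 = 0 \<longrightarrow>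
      norm (c1 *\<^sub>R (\<Phi> T (x + h1) - \<Phi> T x) + c2 *\<^sub>R (\<Phi> T (x + h2) - \<Phi> T x) + c3 *\<^sub>R (\<Phi> T (x + h3) - \<Phi> T x))
        \<le> \<epsilon> * (\<bar>c1\<bar> * norm h1 + \<bar>c2\<bar> * norm h2 + \<bar>c3\<bar> * norm h3)"
  proof (intro exI[of _ \<delta>] conjI allI impI; (elim conjE)?)
    show "\<delta> > 0" using r \<delta>0 E by (simp add: \<delta>_def)
    fix h1 h2 h3 :: "real^2" and c1 c2 c3 :: real
    assume h: "norm h1 < \<delta>" "norm h2 < \<delta>" "norm h3 < \<delta>" and sum0: "c1 *\<^sub>R h1 + c2 *\<^sub>R h2 + c3 *\<^sub>R h3 = 0"
    define w where "w h t = \<Phi> t (x + h) - \<Phi> t x" for h t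
    define dw where "dw h t = V (\<Phi> t (x + h)) - V (\<Phi> t x)" for h t
    define e where "e = \<epsilon> / E * (\<bar>c1\<bar> * norm h1 + \<bar>c2\<bar> * norm h2 + \<bar>c3\<bar> * norm h3)"
    have hX: "x + h \<in> X" if "norm h < \<delta>" for h
    proof -
      have "x + h \<in> ball x r"
        using that by (simp add: \<delta>_def dist_norm)
      then show ?thesis using r(2) closure_subset by blast
    qed
    have w_deriv: "(w h has_vector_derivative dw h t) (at t)" if "norm h < \<delta>" for h t
      unfolding w_def dw_def
      using \<Phi>_deriv[OF hX[OF that]] \<Phi>_deriv[OF xX] by (intro has_vector_derivative_diff)
    have w_err: "norm (dw h t - blinfun_apply (V' (\<Phi> t x)) (w h t)) \<le> \<epsilon> / E * norm h"
      if h: "norm h < \<delta>" and t: "\<bar>t\<bar> \<le> \<bar>T\<bar>" for h t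
    proof -
      have "norm (w h t) \<le> norm h * exp ((L + 1) * \<bar>t\<bar>)"
        unfolding w_def using \<Phi>_dist[OF hX[OF h] xX, of t] by simp
      also have "\<dots> \<le> norm h * E"
        unfolding E_def using t L_pos by (intro mult_left_mono) auto
      finally have w: "norm (w h t) \<le> norm h * E" .
      also have "\<dots> < \<delta>0"
        using h E by (simp add: \<delta>_def pos_less_divide_eq)
      finally have "dist (\<Phi> t x) (\<Phi> t (x + h)) < \<delta>0"
        by (simp add: w_def dist_norm norm_minus_commute)
      then have "norm (dw h t - blinfun_apply (V' (\<Phi> t x)) (w h t)) \<le> \<epsilon> / (E * E) * norm (w h t)"
        unfolding w_def dw_def using xX hX[OF h] by (intro \<delta>0) auto
      also have "\<dots> \<le> \<epsilon> / (E * E) * (norm h * E)"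
        using w \<open>\<epsilon> > 0\<close> E by (intro mult_left_mono) auto
      also have "\<dots> = \<epsilon> / E * norm h"
        using E by simp
      finally show ?thesis .
    qed
    define W where "W t = c1 *\<^sub>R w h1 t + c2 *\<^sub>R w h2 t + c3 *\<^sub>R w h3 t" for t
    define W' where "W' t = c1 *\<^sub>R dw h1 t + c2 *\<^sub>R dw h2 t + c3 *\<^sub>R dw h3 t" for t
    have "norm (W T) \<le> (norm (W 0) + e) * exp ((L + 1) * \<bar>T\<bar>)"
    proof (rule gronwall_bound)
      show "(W has_vector_derivative W' t) (at t)" for t
        unfolding W_def W'_def using w_deriv h
        by (intro has_vector_derivative_add bounded_linear.has_vector_derivative[OF bounded_linear_scaleR_right])
      fix t assume t: "\<bar>t\<bar> \<le> \<bar>T\<bar>"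
      define A where "A = blinfun_apply (V' (\<Phi> t x))"
      have "W' t = A (W t) + (c1 *\<^sub>R (dw h1 t - A (w h1 t)) + c2 *\<^sub>R (dw h2 t - A (w h2 t)) + c3 *\<^sub>R (dw h3 t - A (w h3 t)))"
        unfolding W_def W'_def A_def by (simp add: blinfun.add_right blinfun.scaleR_right algebra_simps)
      also have "norm \<dots> \<le> L * norm (W t) + (\<bar>c1\<bar> * (\<epsilon> / E * norm h1) + \<bar>c2\<bar> * (\<epsilon> / E * norm h2) + \<bar>c3\<bar> * (\<epsilon> / E * norm h3))"
      proof (intro norm_triangle_mono)
        have "norm (A (W t)) \<le> norm (V' (\<Phi> t x)) * norm (W t)"
          unfolding A_def by (rule norm_blinfun)
        also have "\<dots> \<le> L * norm (W t)"
          using V'_bound[of "\<Phi> t x"] xX by (intro mult_right_mono) auto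
        finally show "norm (A (W t)) \<le> L * norm (W t)" .
      qed (use w_err h t in \<open>auto simp: A_def intro!: mult_left_mono simp del: times_divide_eq_left\<close>)
      also have "\<dots> = L * norm (W t) + e"
        by (simp add: e_def algebra_simps)
      finally show "norm (W' t) \<le> L * norm (W t) + e" .
    qed (use L_pos E \<open>\<epsilon> > 0\<close> in \<open>auto simp: e_def\<close>)
    moreover have "W 0 = 0"
      unfolding W_def w_def using sum0 hX h xX by simp
    ultimately have "norm (W T) \<le> e * E"
      by (simp add: E_def)
    also have "e * E = \<epsilon> * (\<bar>c1\<bar> * norm h1 + \<bar>c2\<bar> * norm h2 + \<bar>c3\<bar> * norm h3)"
      using E by (simp add: e_def)
    finally show "norm (c1 *\<^sub>R (\<Phi> T (x + h1) - \<Phi> T x) + c2 *\<^sub>R (\<Phi> T (x + h2) - \<Phi> T x) + c3 *\<^sub>R (\<Phi> T (x + h3) - \<Phi> T x))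
        \<le> \<epsilon> * (\<bar>c1\<bar> * norm h1 + \<bar>c2\<bar> * norm h2 + \<bar>c3\<bar> * norm h3)"
      by (simp add: W_def w_def)
  qed
qed

text \<open>The numerator in \<open>period_difference\<close> with \<open>a = x\<close> is close to
  the differentiable function \<open>F\<close> at \<open>y\<close>, indeed equal to it, while
  \<open>q\<close> tends to \<open>a0\<close>; so the derivative is \<open>F' / a0\<close>.\<close>

lemma P_gradient:
  assumes x: "x \<in> N" and x\<Omega>: "x \<in> \<Omega>"
  shows "GDERIV P x :> grad P x"
proof -
  define a0 where "a0 = V x \<bullet> V x"
  have a0: "a0 > 0" using N_V_nonzero[OF x] by (simp add: a0_def)
  have xX: "x \<in> X" using x by simp
  obtain D where D: "(\<Phi> (P x) has_derivative D) (at x)"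
    using \<Phi>_differentiable[OF x\<Omega>] by blast
  define F where "F y = V x \<bullet> ((y - x) - (\<Phi> (P x) y - \<Phi> (P x) x))" for y
  define F' where "F' h = V x \<bullet> (h - D h)" for h
  have F: "(F has_derivative F') (at x)"
    unfolding F_def F'_def by (auto intro!: derivative_eq_intros D)
  have lin: "bounded_linear F'" by (rule has_derivative_bounded_linear[OF F])
  define C where "C = 2 * (norm (V x) * (1 + exp ((L + 1) * P x))) / a0"
  have "norm (V x) > 0" using N_V_nonzero[OF x] by simp
  then have C: "C > 0" using a0 by (simp add: C_def add_pos_pos)
  obtain r where r: "r > 0" "ball x r \<subseteq> \<Omega>"
    using open_domain x\<Omega> openE by blast
  have "(P has_derivative (\<lambda>h. F' h / a0)) (at x)"
    unfolding has_derivative_at_alt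
  proof (intro conjI allI impI)
    show "bounded_linear (\<lambda>h. F' h / a0)"
      by (rule bounded_linear_compose[OF bounded_linear_divide lin])
    fix \<epsilon> :: real assume "\<epsilon> > 0"
    then have "\<epsilon> * a0 / 2 > 0" using a0 by simp
    then obtain \<delta>1 where \<delta>1: "\<delta>1 > 0"
      "\<And>y. norm (y - x) < \<delta>1 \<Longrightarrow> norm (F y - F x - F' (y - x)) \<le> \<epsilon> * a0 / 2 * norm (y - x)"
      using F unfolding has_derivative_at_alt by meson
    \<comment> \<open>The first bound keeps \<open>q\<close> away from 0 and yields the Lipschitz
      constant \<open>C\<close>; the second makes the error \<open>R * (a0 - q)\<close> at most half
      of the allowed one.\<close>
    have "min (a0 / 2) (\<epsilon> * a0 / (2 * C)) > 0" using \<open>\<epsilon> > 0\<close> a0 C by simp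
    then obtain \<delta>2 where \<delta>2: "\<delta>2 > 0"
      "\<And>a b. a \<in> X \<Longrightarrow> b \<in> X \<Longrightarrow> dist a x < \<delta>2 \<Longrightarrow> dist b x < \<delta>2 \<Longrightarrow>
        \<exists>q. \<bar>q - V x \<bullet> V x\<bar> < min (a0 / 2) (\<epsilon> * a0 / (2 * C)) \<and>
          (P b - P a) * q = V x \<bullet> ((b - a) - (\<Phi> (P a) b - \<Phi> (P a) a))"
      by (rule period_difference[OF x]) blast
    have "norm (P y - P x - F' (y - x) / a0) \<le> \<epsilon> * norm (y - x)" if y: "norm (y - x) < Min {\<delta>1, \<delta>2, r}" for y
    proof -
      have "y \<in> ball x r"
        using y by (simp add: dist_norm norm_minus_commute)
      then have yX: "y \<in> X"
        using r(2) closure_subset by blast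
      obtain q where q: "\<bar>q - a0\<bar> < min (a0 / 2) (\<epsilon> * a0 / (2 * C))" "(P y - P x) * q = F y"
        using \<delta>2(2)[OF xX yX] y \<delta>2(1) unfolding a0_def[symmetric] F_def[symmetric] by (auto simp: dist_norm)
      define R where "R = P y - P x"
      have "\<bar>R\<bar> * (a0 / 2) \<le> \<bar>R\<bar> * \<bar>q\<bar>"
        using q(1) by (intro mult_left_mono) (auto simp: abs_if split: if_splits)
      also have "\<dots> = \<bar>F y\<bar>"
        by (simp add: q(2)[symmetric] abs_mult R_def)
      also have "\<dots> \<le> norm (V x) * (1 + exp ((L + 1) * P x)) * norm (y - x)"
        unfolding F_def using return_displacement[OF xX yX, of "P x" "P x"] P_pos[OF x] by simp
      finally have R: "\<bar>R\<bar> \<le> C * norm (y - x)"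
        using a0 by (simp add: C_def field_simps)
      have "\<bar>R * (a0 - q)\<bar> \<le> C * norm (y - x) * (\<epsilon> * a0 / (2 * C))"
        unfolding abs_mult using R q(1) C by (intro mult_mono) (auto simp: abs_minus_commute)
      also have "\<dots> = \<epsilon> * a0 / 2 * norm (y - x)"
        using C by simp
      finally have 1: "\<bar>R * (a0 - q)\<bar> \<le> \<epsilon> * a0 / 2 * norm (y - x)" .
      have 2: "\<bar>R * q - F' (y - x)\<bar> \<le> \<epsilon> * a0 / 2 * norm (y - x)"
        using \<delta>1(2)[of y] y q(2) by (simp add: R_def F_def)
      have "a0 * \<bar>R - F' (y - x) / a0\<bar> = \<bar>R * (a0 - q) + (R * q - F' (y - x))\<bar>"
      proof -
        have "a0 * \<bar>R - F' (y - x) / a0\<bar> = \<bar>a0 * (R - F' (y - x) / a0)\<bar>"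
          using a0 by (simp add: abs_mult)
        also have "a0 * (R - F' (y - x) / a0) = R * (a0 - q) + (R * q - F' (y - x))"
          using a0 by (simp add: algebra_simps)
        finally show ?thesis .
      qed
      also have "\<dots> \<le> \<epsilon> * a0 / 2 * norm (y - x) + \<epsilon> * a0 / 2 * norm (y - x)"
        by (rule order.trans[OF abs_triangle_ineq add_mono[OF 1 2]])
      also have "\<dots> = a0 * (\<epsilon> * norm (y - x))"
        by (simp add: algebra_simps)
      finally show ?thesis using a0 by (simp add: R_def)
    qed
    moreover have "Min {\<delta>1, \<delta>2, r} > 0" using \<delta>1(1) \<delta>2(1) r(1) by simp
    ultimately show "\<exists>d>0. \<forall>y. norm (y - x) < d \<longrightarrow> norm (P y - P x - F' (y - x) / a0) \<le> \<epsilon> * norm (y - x)"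
      by blast
  qed
  then show ?thesis by (rule GDERIV_grad)
qed

text \<open>\<open>P\<close> is constant along orbits. This fixes the direction of the gradient, so
  that a lower bound for its norm controls every derivative transversal to \<open>V\<close>.\<close>

lemma P_gradient_perp:
  assumes x: "x \<in> N" and x\<Omega>: "x \<in> \<Omega>"
  shows "grad P x \<bullet> V x = 0"
proof -
  have xX: "x \<in> X" using x by simp
  have "((\<lambda>s. P (\<Phi> s x)) has_derivative (\<lambda>h. (h *\<^sub>R V x) \<bullet> grad P x)) (at 0)"
    using has_derivative_compose[OF \<Phi>_deriv[OF xX, of 0, unfolded has_vector_derivative_def], of P "\<lambda>h. h \<bullet> grad P x"]
      P_gradient[OF assms, unfolded gderiv_def] xX by auto
  moreover have "((\<lambda>s. P (\<Phi> s x)) has_derivative (\<lambda>h. 0)) (at 0)"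
    using P_invariant[OF xX] by simp
  ultimately have "(\<lambda>h. (h *\<^sub>R V x) \<bullet> grad P x) = (\<lambda>h. 0)"
    by (rule has_derivative_unique)
  then show ?thesis by (metis inner_commute scaleR_one)
qed

end

section \<open>Compact sets of periodic orbits\<close>

definition rot :: "real^2 \<Rightarrow> real^2" where
  "rot v = vector [v $ 2, - (v $ 1)]"

lemma rot_component [simp]: "rot v $ 1 = v $ 2" "rot v $ 2 = - (v $ 1)"
  by (simp_all add: rot_def)

lemma norm_rot [simp]: "norm (rot v) = norm v"
  by (simp add: norm_vec_def L2_set_def sum_2 add.commute)

text \<open>\<open>v \<bullet> rot \<eta>\<close> is the determinant of \<open>v\<close> and
  \<open>\<eta>\<close>. The axis \<open>\<nu>\<close> is tilted by \<open>\<alpha>\<close> towards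
  the side \<open>\<sigma>\<close> for which the two terms of this determinant do not cancel; since
  \<open>\<alpha> < pi / 4\<close>, the smaller weight is \<open>sin \<alpha>\<close>.\<close>

lemma cone_direction:
  fixes \<nu> v :: "real^2"
  assumes \<nu>: "norm \<nu> = 1" and \<alpha>: "0 < \<alpha>" "\<alpha> < pi / 4"
  obtains \<eta> where "norm \<eta> = 1" "\<eta> \<bullet> \<nu> = cos \<alpha>" "\<bar>v \<bullet> rot \<eta>\<bar> \<ge> sin \<alpha> * norm v"
proof -
  define x where "x = v \<bullet> rot \<nu>"
  define y where "y = v \<bullet> \<nu>"
  define \<sigma> where "\<sigma> = (if x * y \<ge> 0 then 1 else - 1 :: real)"
  define \<eta> where "\<eta> = cos \<alpha> *\<^sub>R \<nu> - (\<sigma> * sin \<alpha>) *\<^sub>R rot \<nu>"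
  have \<nu>2: "\<nu> $ 1 * \<nu> $ 1 + \<nu> $ 2 * \<nu> $ 2 = 1"
    using \<nu> by (simp add: norm_eq_1 inner_vec_def sum_2)
  have \<sigma>2: "\<sigma> * \<sigma> = 1" by (simp add: \<sigma>_def)
  have sc: "sin \<alpha> * sin \<alpha> + cos \<alpha> * cos \<alpha> = 1"
    using sin_cos_squared_add[of \<alpha>] by (simp add: power2_eq_square)
  have s0: "sin \<alpha> > 0" using \<alpha> by (intro sin_gt_zero) auto
  have le: "sin \<alpha> \<le> cos \<alpha>"
  proof -
    have "sin \<alpha> \<le> sin (pi / 2 - \<alpha>)"
      using \<alpha> by (intro sin_monotone_2pi_le) auto
    then show ?thesis by (simp add: cos_sin_eq)
  qed
  have "\<eta> \<bullet> \<eta> = 1"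
  proof -
    have "\<eta> \<bullet> \<eta> = (cos \<alpha> * cos \<alpha> + (\<sigma> * \<sigma>) * (sin \<alpha> * sin \<alpha>)) * (\<nu> $ 1 * \<nu> $ 1 + \<nu> $ 2 * \<nu> $ 2)"
      by (simp add: \<eta>_def inner_vec_def sum_2 algebra_simps)
    then show ?thesis using \<nu>2 \<sigma>2 sc by simp
  qed
  then have 1: "norm \<eta> = 1" by (simp add: norm_eq_1)
  have 2: "\<eta> \<bullet> \<nu> = cos \<alpha>"
  proof -
    have "\<eta> \<bullet> \<nu> = cos \<alpha> * (\<nu> $ 1 * \<nu> $ 1 + \<nu> $ 2 * \<nu> $ 2)"
      by (simp add: \<eta>_def inner_vec_def sum_2 algebra_simps)
    then show ?thesis using \<nu>2 by simp
  qed
  have "v \<bullet> rot \<eta> = cos \<alpha> * x + \<sigma> * sin \<alpha> * y"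
    by (simp add: \<eta>_def x_def y_def inner_vec_def sum_2 algebra_simps)
  also have "\<bar>\<dots>\<bar> = cos \<alpha> * \<bar>x\<bar> + sin \<alpha> * \<bar>y\<bar>"
  proof -
    have c0: "cos \<alpha> \<ge> 0" using s0 le by linarith
    have "(0 \<le> x \<and> 0 \<le> y) \<or> (x \<le> 0 \<and> y \<le> 0)" if "x * y \<ge> 0"
      using that by (simp add: zero_le_mult_iff)
    moreover have "(0 \<le> x \<and> y \<le> 0) \<or> (x \<le> 0 \<and> 0 \<le> y)" if "\<not> x * y \<ge> 0"
      using that by (auto simp: zero_le_mult_iff)
    ultimately have "(0 \<le> x \<and> 0 \<le> \<sigma> * y) \<or> (x \<le> 0 \<and> \<sigma> * y \<le> 0)" "\<bar>\<sigma> * y\<bar> = \<bar>y\<bar>"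
      unfolding \<sigma>_def by auto
    moreover from this(1) have "(0 \<le> cos \<alpha> * x \<and> 0 \<le> sin \<alpha> * (\<sigma> * y)) \<or> (cos \<alpha> * x \<le> 0 \<and> sin \<alpha> * (\<sigma> * y) \<le> 0)"
      using c0 s0 by (auto simp: mult_nonneg_nonpos)
    then have "\<bar>cos \<alpha> * x + sin \<alpha> * (\<sigma> * y)\<bar> = \<bar>cos \<alpha> * x\<bar> + \<bar>sin \<alpha> * (\<sigma> * y)\<bar>"
      by linarith
    ultimately show ?thesis
      using c0 s0 by (simp add: abs_mult mult_ac)
  qed
  also have "\<dots> \<ge> sin \<alpha> * (\<bar>x\<bar> + \<bar>y\<bar>)"
    using le mult_right_mono[OF le, of "\<bar>x\<bar>"] by (simp add: distrib_left)
  finally have "\<bar>v \<bullet> rot \<eta>\<bar> \<ge> sin \<alpha> * (\<bar>x\<bar> + \<bar>y\<bar>)" .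
  moreover have "norm v \<le> \<bar>x\<bar> + \<bar>y\<bar>"
  proof (rule power2_le_imp_le)
    have "(norm v)\<^sup>2 = (v $ 1 * v $ 1 + v $ 2 * v $ 2) * (\<nu> $ 1 * \<nu> $ 1 + \<nu> $ 2 * \<nu> $ 2)"
      using \<nu>2 by (simp add: power2_norm_eq_inner inner_vec_def sum_2)
    also have "\<dots> = x\<^sup>2 + y\<^sup>2"
      by (simp add: x_def y_def inner_vec_def sum_2 algebra_simps power2_eq_square)
    also have "\<dots> \<le> (\<bar>x\<bar> + \<bar>y\<bar>)\<^sup>2"
      by (simp add: power2_sum)
    finally show "(norm v)\<^sup>2 \<le> (\<bar>x\<bar> + \<bar>y\<bar>)\<^sup>2" .
  qed simp
  ultimately have 3: "\<bar>v \<bullet> rot \<eta>\<bar> \<ge> sin \<alpha> * norm v"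
    using s0 mult_left_mono[of "norm v" "\<bar>x\<bar> + \<bar>y\<bar>" "sin \<alpha>"] by linarith
  show ?thesis using that[OF 1 2 3] .
qed

text \<open>If \<open>v \<noteq> 0\<close>, then \<open>g\<close> is a multiple of the quarter turn
  of \<open>v\<close>. The identity is cleared of the quotient \<open>norm g / norm v\<close>, so
  \<open>v = 0\<close> needs no separate case.\<close>

lemma inner_perp_rot:
  fixes g v \<eta> :: "real^2"
  assumes "g \<bullet> v = 0"
  shows "\<bar>g \<bullet> \<eta>\<bar> * norm v = norm g * \<bar>v \<bullet> rot \<eta>\<bar>"
proof -
  have "(g1 * e1 + g2 * e2)\<^sup>2 * (v1 * v1 + v2 * v2) = (g1 * g1 + g2 * g2) * (v1 * e2 - v2 * e1)\<^sup>2"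
    if "g1 * v1 + g2 * v2 = 0" for g1 g2 v1 v2 e1 e2 :: real
    using that by algebra
  from this[of "g $ 1" "v $ 1" "g $ 2" "v $ 2" "\<eta> $ 1" "\<eta> $ 2"]
  have "(\<bar>g \<bullet> \<eta>\<bar> * norm v)\<^sup>2 = (norm g * \<bar>v \<bullet> rot \<eta>\<bar>)\<^sup>2"
    using assms by (simp add: power_mult_distrib power2_norm_eq_inner inner_vec_def sum_2)
  then show ?thesis
    by (rule power2_eq_imp_eq) auto
qed

text \<open>The values \<open>\<theta> / k\<close> below \<open>T\<close> are spaced by at most \<open>T\<^sup>2 / \<theta>\<close>.\<close>

lemma ivt_reciprocal_integer:
  fixes f :: "real \<Rightarrow> real"
  assumes s: "0 \<le> s" and f: "continuous_on {0..s} f"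
    and pos: "0 < f 0" "0 < f s" and le: "f 0 \<le> T" "f s \<le> T"
    and \<theta>: "\<theta> > 0" and var: "T\<^sup>2 \<le> \<theta> * \<bar>f s - f 0\<bar>"
  obtains r k where "0 \<le> r" "r \<le> s" "of_int k * f r = \<theta>"
proof -
  define lo where "lo = min (f 0) (f s)"
  define hi where "hi = max (f 0) (f s)"
  have lohi: "0 < lo" "lo \<le> hi" "hi \<le> T" "\<bar>f s - f 0\<bar> = hi - lo"
    using pos le by (auto simp: lo_def hi_def)
  have "lo * hi \<le> T\<^sup>2"
    unfolding power2_eq_square using lohi by (intro mult_mono) auto
  then have "lo * hi \<le> \<theta> * (hi - lo)"
    using var lohi(4) by simp
  \<comment> \<open>The interval from \<open>\<theta> / hi\<close> to \<open>\<theta> / lo\<close>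
    has length at least 1 and so contains an integer \<open>k\<close>; then
    \<open>\<theta> / k\<close> lies between the end values of \<open>f\<close>.\<close>
  then have gap: "\<theta> / hi + 1 \<le> \<theta> / lo"
    using lohi by (simp add: field_simps)
  define k where "k = \<lceil>\<theta> / hi\<rceil>"
  have k: "\<theta> / hi \<le> of_int k" "of_int k \<le> \<theta> / lo"
    using gap unfolding k_def by linarith+
  have "\<theta> / hi > 0" using \<theta> lohi by simp
  then have kpos: "real_of_int k > 0" using k(1) by linarith
  have v: "lo \<le> \<theta> / of_int k" "\<theta> / of_int k \<le> hi"
    using k kpos lohi by (simp_all add: field_simps)
  have "\<exists>r. 0 \<le> r \<and> r \<le> s \<and> f r = \<theta> / of_int k"
  proof (cases "f 0 \<le> f s")
    case True
    then show ?thesis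
      using IVT'[OF _ _ s f, of "\<theta> / of_int k"] v by (auto simp: lo_def hi_def)
  next
    case False
    then show ?thesis
      using IVT2'[OF _ _ s f, of "\<theta> / of_int k"] v by (auto simp: lo_def hi_def)
  qed
  then obtain r where "0 \<le> r" "r \<le> s" "f r = \<theta> / of_int k" by blast
  then show ?thesis using that[of r k] kpos by simp
qed

section \<open>Uniform constants on compact sets of periodic points\<close>

context hamiltonian_flow
begin

lemma P_lipschitz_compact:
  assumes "compact K" "K \<subseteq> N"
  obtains C where "C-lipschitz_on K P"
proof (rule lipschitz_on_compact_of_local[OF assms(1)])
  fix x assume "x \<in> K"
  then have "x \<in> N" using assms by blast
  then obtain u C where "u > 0" "C-lipschitz_on (cball x u \<inter> X) P"
    by (rule P_locally_lipschitz)
  moreover have "cball x u \<inter> K \<subseteq> cball x u \<inter> X" using assms by blast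
  ultimately show "\<exists>u>0. \<exists>L. L-lipschitz_on (cball x u \<inter> K) P"
    using lipschitz_on_subset by blast
qed blast

lemma compact_bounds:
  assumes "compact K" "K \<subseteq> N"
  obtains B where "B > 0" "\<And>x. x \<in> K \<Longrightarrow> P x \<le> B" "\<And>x. x \<in> K \<Longrightarrow> 1 \<le> B * P x"
    "\<And>x. x \<in> K \<Longrightarrow> 1 \<le> B * norm (V x)"
proof -
  have pos: "P x > 0" "norm (V x) > 0" if "x \<in> K" for x
    using that assms P_pos[of x] N_V_nonzero[of x] by auto
  obtain C where C: "C-lipschitz_on K P" by (rule P_lipschitz_compact[OF assms])
  have cP: "continuous_on K P" by (rule lipschitz_on_continuous_on[OF C])
  have cV: "continuous_on K V"
    using assms by (intro continuous_on_subset[OF lipschitz_on_continuous_on[OF V_lipschitz]]) auto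
  have bd: "\<exists>B. \<forall>x\<in>K. f x \<le> B" if "continuous_on K f" for f :: "real^2 \<Rightarrow> real"
    using compact_imp_bounded[OF compact_continuous_image[OF that assms(1)]]
    unfolding bounded_iff by (auto simp: abs_le_iff)
  obtain B1 where B1: "\<And>x. x \<in> K \<Longrightarrow> P x \<le> B1"
    using bd[OF cP] by blast
  have "continuous_on K (\<lambda>x. 1 / P x)"
    using cP pos(1) by (intro continuous_intros) (auto simp: less_imp_neq[symmetric])
  then obtain B2 where B2: "\<And>x. x \<in> K \<Longrightarrow> 1 / P x \<le> B2"
    using bd by blast
  have "continuous_on K (\<lambda>x. 1 / norm (V x))"
    using cV pos(2) by (intro continuous_intros) auto
  then obtain B3 where B3: "\<And>x. x \<in> K \<Longrightarrow> 1 / norm (V x) \<le> B3"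
    using bd by blast
  define B where "B = Max {1, B1, B2, B3}"
  show ?thesis
  proof (rule that)
    show "B > 0" unfolding B_def by (simp add: less_max_iff_disj)
    fix x assume x: "x \<in> K"
    have "P x \<le> B" "1 / P x \<le> B" "1 / norm (V x) \<le> B"
      unfolding B_def using B1[OF x] B2[OF x] B3[OF x] by auto
    then show "P x \<le> B" "1 \<le> B * P x" "1 \<le> B * norm (V x)"
      using pos[OF x] by (simp_all add: pos_divide_le_eq)
  qed
qed

text \<open>Periods on \<open>K0\<close> are at most some \<open>B\<close>, so flowing for the
  compact time interval \<open>{0..B}\<close> already sweeps out whole orbits. Invariance matters
  because \<open>away d\<close> need not be invariant while the estimates concern whole
  orbits.\<close>

lemma invariant_compact:
  assumes "compact K0" "K0 \<subseteq> N"
  obtains K where "compact K" "K \<subseteq> N" "K0 \<subseteq> K" "\<And>t x. x \<in> K \<Longrightarrow> \<Phi> t x \<in> K"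
proof -
  obtain B where B: "B > 0" "\<And>x. x \<in> K0 \<Longrightarrow> P x \<le> B"
    by (rule compact_bounds[OF assms]) blast
  define K where "K = (\<lambda>(t, x). \<Phi> t x) ` ({0..B} \<times> K0)"
  have orbit_in: "\<Phi> t x \<in> K" if x: "x \<in> K0" for t x
  proof -
    have xN: "x \<in> N" using x assms by blast
    obtain k :: int where k: "0 \<le> t - of_int k * P x" "t - of_int k * P x < P x"
      by (rule time_mod_P[OF xN])
    have "\<Phi> t x = \<Phi> (t - of_int k * P x) x"
      using \<Phi>_mod_P[OF xN, of "t - of_int k * P x" k] by simp
    then show ?thesis
      using k B(2)[OF x] x by (auto simp: K_def intro!: image_eqI[of _ _ "(t - of_int k * P x, x)"])
  qed
  show ?thesis
  proof (rule that)
    show "compact K"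
      unfolding K_def using assms
      by (intro compact_continuous_image continuous_on_subset[OF continuous_on_\<Phi>] compact_Times) auto
    show "K \<subseteq> N"
    proof
      fix z assume "z \<in> K"
      then obtain t x where "x \<in> K0" "z = \<Phi> t x" by (auto simp: K_def)
      then show "z \<in> N" using \<Phi>_in_N assms by blast
    qed
    show "K0 \<subseteq> K"
    proof
      fix x assume "x \<in> K0"
      then show "x \<in> K" using orbit_in[of x 0] assms by auto
    qed
    fix t z assume "z \<in> K"
    then obtain s x where x: "x \<in> K0" "z = \<Phi> s x" by (auto simp: K_def)
    moreover have "x \<in> X" using x assms by blast
    ultimately show "\<Phi> t z \<in> K" using orbit_in[of x "t + s"] \<Phi>_add[of x t s] by simp
  qed
qed

lemma \<Phi>_linear_growth:
  assumes "compact K" "K \<subseteq> N"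
  obtains Q where "Q > 0"
    "\<And>a b t. a \<in> K \<Longrightarrow> b \<in> K \<Longrightarrow> norm (\<Phi> t a - \<Phi> t b) \<le> Q * (1 + \<bar>t\<bar>) * norm (a - b)"
proof -
  obtain B where B: "B > 0" "\<And>x. x \<in> K \<Longrightarrow> P x \<le> B" "\<And>x. x \<in> K \<Longrightarrow> 1 \<le> B * P x"
    by (rule compact_bounds[OF assms]) blast
  obtain C where C: "C-lipschitz_on K P" by (rule P_lipschitz_compact[OF assms])
  have C0: "C \<ge> 0" by (rule lipschitz_on_nonneg[OF C])
  define E where "E = exp ((L + 1) * B)"
  \<comment> \<open>\<open>E\<close> bounds the separation within one turn; the other two terms
    bound the shift \<open>\<bar>k\<bar> * \<bar>P b - P a\<bar>\<close> in time, with
    \<open>\<bar>k\<bar> \<le> 1 + B * \<bar>t\<bar>\<close>.\<close>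
  define Q where "Q = E + L * C + L * C * B"
  have E: "E > 0" by (simp add: E_def)
  have LC: "L * C \<ge> 0" using C0 L_pos by simp
  show ?thesis
  proof (rule that[of Q])
    show "Q > 0" using E LC B(1) by (simp add: Q_def add_pos_nonneg)
    fix a b t assume ab: "a \<in> K" "b \<in> K"
    have N: "a \<in> N" "b \<in> N" using ab assms by auto
    obtain k :: int where k: "0 \<le> t - of_int k * P a" "t - of_int k * P a < P a"
      by (rule time_mod_P[OF N(1)])
    define \<tau> where "\<tau> = t - of_int k * P a"
    have \<tau>: "0 \<le> \<tau>" "\<tau> \<le> B" using k B(2)[OF ab(1)] by (auto simp: \<tau>_def)
    have a: "\<Phi> t a = \<Phi> \<tau> a"
      using \<Phi>_mod_P[OF N(1), of \<tau> k] by (simp add: \<tau>_def)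
    \<comment> \<open>The number of turns \<open>k\<close> is that of \<open>a\<close>; the time
      left for \<open>b\<close> may fall outside \<open>{0..<P b}\<close>, which does no
      harm.\<close>
    have b: "\<Phi> t b = \<Phi> (t - of_int k * P b) b"
      using \<Phi>_mod_P[OF N(2), of "t - of_int k * P b" k] by simp
    have kb: "\<bar>of_int k\<bar> \<le> 1 + B * \<bar>t\<bar>"
    proof -
      have Pa: "P a > 0" by (rule P_pos[OF N(1)])
      have "\<bar>of_int k\<bar> * P a = \<bar>of_int k * P a\<bar>" using Pa by (simp add: abs_mult)
      also have "\<dots> \<le> \<bar>t\<bar> + P a" using k by linarith
      also have "\<dots> \<le> (B * P a) * \<bar>t\<bar> + P a"
        using mult_right_mono[OF B(3)[OF ab(1)], of "\<bar>t\<bar>"] by simp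
      also have "\<dots> = (1 + B * \<bar>t\<bar>) * P a" by (simp add: algebra_simps)
      finally show ?thesis using Pa by simp
    qed
    have "norm (\<Phi> t a - \<Phi> t b) \<le> norm (a - b) * exp ((L + 1) * \<bar>\<tau>\<bar>) + L * \<bar>\<tau> - (t - of_int k * P b)\<bar>"
      unfolding a b using N by (intro \<Phi>_dist2) auto
    also have "norm (a - b) * exp ((L + 1) * \<bar>\<tau>\<bar>) \<le> norm (a - b) * E"
      unfolding E_def using \<tau> L_pos by (intro mult_left_mono) auto
    also have "\<bar>\<tau> - (t - of_int k * P b)\<bar> = \<bar>of_int k\<bar> * \<bar>P b - P a\<bar>"
      by (simp add: \<tau>_def abs_mult[symmetric] algebra_simps)
    also have "L * \<dots> \<le> L * ((1 + B * \<bar>t\<bar>) * (C * norm (a - b)))"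
      using lipschitz_onD[OF C ab(2,1)] kb L_pos B(1)
      by (intro mult_left_mono mult_mono) (auto simp: dist_real_def dist_norm norm_minus_commute)
    also have "norm (a - b) * E + \<dots> = (E + L * C + (L * C * B) * \<bar>t\<bar>) * norm (a - b)"
      by (simp add: algebra_simps)
    also have "\<dots> \<le> (Q * (1 + \<bar>t\<bar>)) * norm (a - b)"
    proof (rule mult_right_mono)
      have "Q * (1 + \<bar>t\<bar>) = E + L * C + (L * C * B) * \<bar>t\<bar> + (L * C * B + (E + L * C) * \<bar>t\<bar>)"
        by (simp add: Q_def algebra_simps)
      moreover have "L * C * B + (E + L * C) * \<bar>t\<bar> \<ge> 0"
        using E C0 L_pos B(1) by (intro add_nonneg_nonneg mult_nonneg_nonneg) auto
      ultimately show "E + L * C + (L * C * B) * \<bar>t\<bar> \<le> Q * (1 + \<bar>t\<bar>)" by linarith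
    qed simp
    finally show "norm (\<Phi> t a - \<Phi> t b) \<le> Q * (1 + \<bar>t\<bar>) * norm (a - b)" by simp
  qed
qed

text \<open>A point of the segment from \<open>\<Phi> t x0\<close> to a point outside \<open>\<Phi> t ` cball x0 r'\<close> lies on the frontier
  of this set, which by invariance of domain is the image of the sphere; pulling it back by
  \<open>\<Phi> (- t)\<close> bounds the length of the segment from below.\<close>

lemma \<Phi>_ball_image:
  assumes Q: "Q > 0" "\<And>a b t. a \<in> K \<Longrightarrow> b \<in> K \<Longrightarrow> norm (\<Phi> t a - \<Phi> t b) \<le> Q * (1 + \<bar>t\<bar>) * norm (a - b)"
    and K: "K \<subseteq> X" "\<And>t x. x \<in> K \<Longrightarrow> \<Phi> t x \<in> K"
    and E: "ball x0 r \<subseteq> E" "E \<subseteq> K" and r: "r > 0"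
  shows "ball (\<Phi> t x0) (r / (Q * (1 + \<bar>t\<bar>))) \<subseteq> \<Phi> t ` E"
proof
  define c where "c = Q * (1 + \<bar>t\<bar>)"
  have c: "c > 0" using Q(1) by (simp add: c_def add_pos_nonneg)
  fix z assume z: "z \<in> ball (\<Phi> t x0) (r / (Q * (1 + \<bar>t\<bar>)))"
  then have "c * dist (\<Phi> t x0) z < r"
    using c by (simp add: c_def[symmetric] pos_less_divide_eq mult.commute)
  \<comment> \<open>With an intermediate radius the closed ball still lies in \<open>E\<close>, and
    its image is compact.\<close>
  then obtain r' where r': "c * dist (\<Phi> t x0) z < r'" "r' < r"
    using dense by blast
  have "r' > 0" using r'(1) c by (smt (verit) mult_nonneg_nonneg zero_le_dist)
  define S where "S = \<Phi> t ` cball x0 r'"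
  have sub: "cball x0 r' \<subseteq> E" using E r'(2) by auto
  have subX: "cball x0 r' \<subseteq> X" using sub E K by blast
  have cont: "continuous_on X (\<Phi> t)"
  proof -
    have "continuous_on X (\<lambda>x. (\<lambda>(t, x). \<Phi> t x) (t, x))"
      by (rule continuous_on_compose2[OF continuous_on_\<Phi>]) (auto intro!: continuous_intros)
    then show ?thesis by simp
  qed
  have "compact S"
    unfolding S_def by (intro compact_continuous_image continuous_on_subset[OF cont subX]) auto
  have "open (\<Phi> t ` ball x0 r')"
  proof (rule invariance_of_domain)
    show "continuous_on (ball x0 r') (\<Phi> t)"
      using subX by (intro continuous_on_subset[OF cont]) auto
    show "inj_on (\<Phi> t) (ball x0 r')"
      using subX \<Phi>_inj by (intro inj_onI) (meson ball_subset_cball subset_iff)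
  qed auto
  then have interior: "\<Phi> t ` ball x0 r' \<subseteq> interior S"
    unfolding S_def by (intro interior_maximal image_mono) auto
  have "z \<in> S"
  proof (rule ccontr)
    assume "z \<notin> S"
    have "\<Phi> t x0 \<in> S" using \<open>r' > 0\<close> by (simp add: S_def)
    then have "closed_segment (\<Phi> t x0) z \<inter> frontier S \<noteq> {}"
      using \<open>z \<notin> S\<close> by (intro connected_Int_frontier) auto
    then obtain w where w: "w \<in> closed_segment (\<Phi> t x0) z" "w \<in> frontier S" by blast
    have "w \<in> S"
      using w(2) \<open>compact S\<close> by (simp add: frontier_def compact_imp_closed)
    then obtain y where y: "y \<in> cball x0 r'" "w = \<Phi> t y" by (auto simp: S_def)
    have "y \<notin> ball x0 r'"
      using interior w(2) unfolding y(2) frontier_def by blast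
    then have "r' \<le> norm (y - x0)"
      by (simp add: dist_norm norm_minus_commute)
    also have "y - x0 = \<Phi> (- t) w - \<Phi> (- t) (\<Phi> t x0)"
      using subX y \<open>r' > 0\<close> by (auto simp: subset_iff)
    also have "norm \<dots> \<le> c * norm (w - \<Phi> t x0)"
    proof -
      have "w \<in> K" "\<Phi> t x0 \<in> K"
        using y sub E K(2) \<open>r' > 0\<close> by (auto simp: subset_iff)
      then show ?thesis using Q(2)[of w "\<Phi> t x0" "- t"] by (simp add: c_def)
    qed
    also have "\<dots> \<le> c * dist (\<Phi> t x0) z"
    proof -
      have "dist w (\<Phi> t x0) \<le> dist (\<Phi> t x0) z"
        using dist_in_closed_segment[OF w(1)] by auto
      then show ?thesis using c by (simp add: dist_norm)
    qed
    also have "\<dots> < r'" by fact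
    finally show False by simp
  qed
  then show "z \<in> \<Phi> t ` E" using sub by (auto simp: S_def)
qed

text \<open>By \<open>inner_perp_rot\<close> the derivative of \<open>P\<close> in direction
  \<open>\<eta>\<close> has absolute value \<open>norm (grad P)\<close> times
  \<open>\<bar>V \<bullet> rot \<eta>\<bar> / norm V\<close>. Along a segment of length at most
  \<open>\<mu> / (2 * L)\<close> the factor \<open>\<bar>V \<bullet> rot \<eta>\<bar>\<close> loses
  at most half of \<open>\<mu>\<close>, and \<open>norm V \<le> L\<close>; this gives the slope
  \<open>\<kappa> * \<mu> / (2 * L)\<close>.\<close>

lemma period_along_segment:
  assumes seg: "\<And>s. 0 \<le> s \<Longrightarrow> s \<le> s1 \<Longrightarrow> p + s *\<^sub>R \<eta> \<in> \<Omega> \<inter> N"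
    and \<kappa>: "\<kappa> > 0" "\<And>s. 0 \<le> s \<Longrightarrow> s \<le> s1 \<Longrightarrow> norm (grad P (p + s *\<^sub>R \<eta>)) \<ge> \<kappa>"
    and \<eta>: "norm \<eta> = 1" "\<bar>V p \<bullet> rot \<eta>\<bar> \<ge> \<mu>" and s1: "0 < s1" "L * s1 \<le> \<mu> / 2"
  shows "\<kappa> * \<mu> / (2 * L) * s1 \<le> \<bar>P (p + s1 *\<^sub>R \<eta>) - P p\<bar>"
    and "continuous_on {0..s1} (\<lambda>s. P (p + s *\<^sub>R \<eta>))"
proof -
  define f where "f s = P (p + s *\<^sub>R \<eta>)" for s
  define f' where "f' s = \<eta> \<bullet> grad P (p + s *\<^sub>R \<eta>)" for s
  have deriv: "(f has_real_derivative f' s) (at s)" if "0 \<le> s" "s \<le> s1" for s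
  proof -
    have "((\<lambda>s. p + s *\<^sub>R \<eta>) has_derivative (\<lambda>h. h *\<^sub>R \<eta>)) (at s)"
      by (auto intro!: derivative_eq_intros)
    moreover have "(P has_derivative (\<lambda>h. h \<bullet> grad P (p + s *\<^sub>R \<eta>))) (at (p + s *\<^sub>R \<eta>))"
      using P_gradient seg[OF that] unfolding gderiv_def by blast
    ultimately have "((\<lambda>s. P (p + s *\<^sub>R \<eta>)) has_derivative (\<lambda>h. (h *\<^sub>R \<eta>) \<bullet> grad P (p + s *\<^sub>R \<eta>))) (at s)"
      by (rule has_derivative_compose)
    then show ?thesis
      unfolding f_def[abs_def] f'_def by (rule has_derivative_imp_has_field_derivative) simp
  qed
  have lower: "\<kappa> * \<mu> / (2 * L) \<le> \<bar>f' s\<bar>" if s: "0 \<le> s" "s \<le> s1" for s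
  proof -
    define y where "y = p + s *\<^sub>R \<eta>"
    have y: "y \<in> N" "y \<in> \<Omega>" using seg[OF s] by (auto simp: y_def)
    have p: "p \<in> X" using seg[of 0] s1 by auto
    have "\<bar>(V y - V p) \<bullet> rot \<eta>\<bar> \<le> norm (V y - V p) * norm (rot \<eta>)"
      by (rule Cauchy_Schwarz_ineq2)
    also have "\<dots> \<le> L * norm (y - p)"
      using V_lip[of y p] y p \<eta>(1) by simp
    also have "\<dots> \<le> L * s1"
      using s L_pos \<eta>(1) by (simp add: y_def)
    also have "\<dots> \<le> \<mu> / 2" by fact
    finally have "\<mu> / 2 \<le> \<bar>V y \<bullet> rot \<eta>\<bar>"
      using \<eta>(2) unfolding inner_diff_left by linarith
    moreover have "\<mu> \<ge> 0"
      using s1 mult_pos_pos[OF L_pos s1(1)] by linarith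
    ultimately have "\<kappa> * (\<mu> / 2) \<le> norm (grad P y) * \<bar>V y \<bullet> rot \<eta>\<bar>"
      using \<kappa>(1) \<kappa>(2)[OF s] unfolding y_def[symmetric]
      by (intro mult_mono') auto
    also have "\<dots> = \<bar>f' s\<bar> * norm (V y)"
      using inner_perp_rot[OF P_gradient_perp[OF y], of \<eta>]
      by (simp add: f'_def y_def inner_commute)
    also have "\<dots> \<le> \<bar>f' s\<bar> * L"
      using V_bound[of y] y by (intro mult_left_mono) auto
    finally show ?thesis using L_pos by (simp add: field_simps)
  qed
  obtain \<xi> where \<xi>: "0 < \<xi>" "\<xi> < s1" "f s1 - f 0 = (s1 - 0) * f' \<xi>"
    using MVT2[OF s1(1) deriv] by blast
  have "\<kappa> * \<mu> / (2 * L) * s1 \<le> \<bar>f' \<xi>\<bar> * s1"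
    using lower[of \<xi>] \<xi> s1 by (intro mult_right_mono) auto
  also have "\<dots> = \<bar>f s1 - f 0\<bar>"
    using \<xi>(3) s1 by (simp add: abs_mult)
  finally show "\<kappa> * \<mu> / (2 * L) * s1 \<le> \<bar>P (p + s1 *\<^sub>R \<eta>) - P p\<bar>"
    by (simp add: f_def)
  show "continuous_on {0..s1} (\<lambda>s. P (p + s *\<^sub>R \<eta>))"
    using deriv unfolding f_def[abs_def, symmetric]
    by (intro continuous_at_imp_continuous_on) (use DERIV_isCont in fastforce)
qed

end

section \<open>Mixing bounds\<close>

context hamiltonian_flow
begin

text \<open>The bound is imposed at every degenerate point instead of through
  \<open>setdist\<close>, which would be 0 for an empty degenerate set.\<close>

definition away :: "real \<Rightarrow> (real^2) set" where
  "away d = {x \<in> X. \<forall>z\<in>degenerate_set \<Omega> \<Phi>. d \<le> dist x z}"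

lemma away_compact: "compact (away d)"
proof -
  have "away d = X \<inter> (\<Inter>z\<in>degenerate_set \<Omega> \<Phi>. {x. d \<le> dist x z})"
    by (auto simp: away_def)
  moreover have "closed (\<Inter>z\<in>degenerate_set \<Omega> \<Phi>. {x. d \<le> dist x z})"
    by (intro closed_INT ballI closed_Collect_le continuous_intros)
  ultimately show ?thesis
    using compact_Int_closed[OF compact_X] by simp
qed

lemma away_subset: "d > 0 \<Longrightarrow> away d \<subseteq> N"
  unfolding away_def by (auto dest: bspec)

lemma orbit_singleton: "orbit \<Phi> {x} = range (\<lambda>t. \<Phi> t x)"
  by (auto simp: orbit_def)

text \<open>Collects the conditions on \<open>A\<close>, so that constants can be chosen from
  \<open>K\<close>, \<open>r0\<close>, \<open>\<beta>0\<close> and \<open>\<kappa>\<close> before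
  \<open>A\<close> appears. \<open>K\<close> is a parameter because it is \<open>away d\<close> at
  first and an invariant compact superset afterwards.\<close>

definition admissible :: "(real^2) set \<Rightarrow> real \<Rightarrow> real \<Rightarrow> real \<Rightarrow> (real^2) set \<Rightarrow> bool" where
  "admissible K r0 \<beta>0 \<kappa> A \<longleftrightarrow>
    A \<subseteq> \<Omega> \<inter> K \<and> orbit_cone_condition \<Phi> A r0 \<beta>0 \<and> (\<forall>x\<in>A. \<kappa> \<le> norm (grad P x))"

lemma mixing_large_time:
  assumes r0: "r0 > 0" and \<beta>0: "0 < \<beta>0" "\<beta>0 < pi / 2" and \<kappa>: "\<kappa> > 0"
    and B: "B > 0" "\<And>x. x \<in> K \<Longrightarrow> P x \<le> B" "\<And>x. x \<in> K \<Longrightarrow> 1 \<le> B * norm (V x)" and K: "K \<subseteq> N"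
  obtains t1 C where "t1 \<ge> 1" "C > 0"
    "\<forall>A t x a. admissible K r0 \<beta>0 \<kappa> A \<and> t1 \<le> t \<and> a \<in> A \<and> x \<in> orbit \<Phi> {a} \<longrightarrow>
      (\<exists>y\<in>A. dist x (\<Phi> t y) \<le> C / t)"
proof -
  \<comment> \<open>Half the opening angle: strictly inside the cone, and below
    \<open>pi / 4\<close> as \<open>cone_direction\<close> requires.\<close>
  define \<alpha> where "\<alpha> = \<beta>0 / 2"
  have \<alpha>: "0 < \<alpha>" "\<alpha> < pi / 4" "\<alpha> < \<beta>0" using \<beta>0 by (auto simp: \<alpha>_def)
  define \<mu> where "\<mu> = sin \<alpha> / B"
  have "sin \<alpha> > 0" using \<alpha> by (intro sin_gt_zero) auto
  then have \<mu>: "\<mu> > 0" using B(1) by (simp add: \<mu>_def)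
  define s0 where "s0 = min r0 (\<mu> / (2 * L))"
  have s0: "s0 > 0" "s0 \<le> r0" "s0 \<le> \<mu> / (2 * L)" using r0 \<mu> L_pos by (auto simp: s0_def)
  define g where "g = \<kappa> * \<mu> / (2 * L)"
  have g: "g > 0" using \<kappa> \<mu> L_pos by (simp add: g_def)
  \<comment> \<open>A walk of length \<open>D / t\<close> changes the period by at least
    \<open>2 * B\<^sup>2 / t\<close>; multiplied by a remaining time of at least
    \<open>t / 2\<close> this is the \<open>B\<^sup>2\<close> that
    \<open>ivt_reciprocal_integer\<close> asks for.\<close>
  define D where "D = 2 * B\<^sup>2 / g"
  have D: "D > 0" using B(1) g by (simp add: D_def)
  \<comment> \<open>\<open>2 * B\<close> guarantees \<open>t - \<tau> \<ge> t / 2\<close>;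
    \<open>D / s0\<close> keeps the walk inside the cone and within the range where \<open>V\<close>
    stays transversal.\<close>
  define t1 where "t1 = Max {1, 2 * B, D / s0}"
  have t1: "t1 \<ge> 1" "t1 \<ge> 2 * B" "t1 \<ge> D / s0" by (auto simp: t1_def)
  define C where "C = D * exp ((L + 1) * B)"
  show ?thesis
  proof (rule that[of t1 C])
    show "t1 \<ge> 1" "C > 0" using t1 D by (auto simp: C_def)
    show "\<forall>A t x a. admissible K r0 \<beta>0 \<kappa> A \<and> t1 \<le> t \<and> a \<in> A \<and> x \<in> orbit \<Phi> {a} \<longrightarrow>
      (\<exists>y\<in>A. dist x (\<Phi> t y) \<le> C / t)"
    proof (intro allI impI; elim conjE)
      fix A and t :: real and x a
      assume adm: "admissible K r0 \<beta>0 \<kappa> A"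
        and t: "t1 \<le> t" and a: "a \<in> A" and x: "x \<in> orbit \<Phi> {a}"
      have A: "A \<subseteq> \<Omega> \<inter> K" "orbit_cone_condition \<Phi> A r0 \<beta>0" "\<forall>x\<in>A. \<kappa> \<le> norm (grad P x)"
        using adm by (simp_all add: admissible_def)
      obtain p \<nu> where p: "p \<in> A" "p \<in> orbit \<Phi> {a}" and \<nu>: "norm \<nu> = 1"
        and cone: "{p + s *\<^sub>R \<xi> | s \<xi>. 0 < s \<and> s \<le> r0 \<and> norm \<xi> = 1 \<and> \<xi> \<bullet> \<nu> > cos \<beta>0} \<subseteq> A"
        using A(2) a unfolding orbit_cone_condition_def by blast
      have AN: "A \<subseteq> \<Omega> \<inter> N" using A(1) K by blast
      have pK: "p \<in> K" and pN: "p \<in> N" and aX: "a \<in> X" using p A(1) a K by auto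
      obtain u v where u: "x = \<Phi> u a" and v: "p = \<Phi> v a"
        using x p(2) by (auto simp: orbit_singleton)
      have "x = \<Phi> (u - v) p"
        using \<Phi>_add[OF aX, of "u - v" v] by (simp add: u v)
      moreover obtain k :: int where k: "0 \<le> (u - v) - of_int k * P p" "(u - v) - of_int k * P p < P p"
        by (rule time_mod_P[OF pN])
      define \<tau> where "\<tau> = (u - v) - of_int k * P p"
      have \<tau>: "0 \<le> \<tau>" "\<tau> \<le> B" using k B(2)[OF pK] by (auto simp: \<tau>_def)
      ultimately have x\<tau>: "x = \<Phi> \<tau> p"
        using \<Phi>_mod_P[OF pN, of \<tau> k] by (simp add: \<tau>_def)
      obtain \<eta> where \<eta>: "norm \<eta> = 1" "\<eta> \<bullet> \<nu> = cos \<alpha>" "\<bar>V p \<bullet> rot \<eta>\<bar> \<ge> sin \<alpha> * norm (V p)"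
        by (rule cone_direction[OF \<nu> \<alpha>(1,2)])
      have cos: "cos \<beta>0 < cos \<alpha>"
        using \<alpha> \<beta>0 by (intro cos_monotone_0_pi) auto
      have seg: "p + s *\<^sub>R \<eta> \<in> A" if "0 \<le> s" "s \<le> r0" for s
      proof (cases "s = 0")
        case False
        then have "p + s *\<^sub>R \<eta> \<in> {p + s *\<^sub>R \<xi> | s \<xi>. 0 < s \<and> s \<le> r0 \<and> norm \<xi> = 1 \<and> \<xi> \<bullet> \<nu> > cos \<beta>0}"
          using that \<eta>(1,2) cos by (intro CollectI exI[of _ s] exI[of _ \<eta>]) auto
        then show ?thesis using cone by blast
      qed (use p in simp)
      have "\<mu> \<le> sin \<alpha> * norm (V p)"
        using B(1) B(3)[OF pK] \<open>sin \<alpha> > 0\<close> mult_left_mono[OF B(3)[OF pK], of "sin \<alpha>"]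
        by (simp add: \<mu>_def field_simps)
      then have \<mu>p: "\<mu> \<le> \<bar>V p \<bullet> rot \<eta>\<bar>" using \<eta>(3) by linarith
      have tpos: "t > 0" using t t1 by linarith
      define s1 where "s1 = D / t"
      have s1: "0 < s1" "s1 \<le> s0"
      proof -
        show "0 < s1" using D tpos by (simp add: s1_def)
        have "D / s0 \<le> t" using t t1 by linarith
        then show "s1 \<le> s0" using s0(1) tpos by (simp add: s1_def field_simps)
      qed
      have s1r: "s1 \<le> r0" and s1\<mu>: "L * s1 \<le> \<mu> / 2"
      proof -
        show "s1 \<le> r0" using s1 s0 by linarith
        have "s1 \<le> \<mu> / (2 * L)" using s1 s0 by linarith
        then show "L * s1 \<le> \<mu> / 2" using L_pos by (simp add: field_simps)
      qed
      have segN: "p + s *\<^sub>R \<eta> \<in> \<Omega> \<inter> N" "\<kappa> \<le> norm (grad P (p + s *\<^sub>R \<eta>))" "P (p + s *\<^sub>R \<eta>) \<le> B"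
        if "0 \<le> s" "s \<le> s1" for s
        using seg[of s] that s1r AN A B(2) by (auto simp: subset_iff)
      have var: "g * s1 \<le> \<bar>P (p + s1 *\<^sub>R \<eta>) - P p\<bar>" and cont: "continuous_on {0..s1} (\<lambda>s. P (p + s *\<^sub>R \<eta>))"
        using period_along_segment[OF segN(1) \<kappa> segN(2) \<eta>(1) \<mu>p s1(1) s1\<mu>] by (simp_all add: g_def)
      have half: "t / 2 \<le> t - \<tau>" using t t1 \<tau> by linarith
      have "B\<^sup>2 = t / 2 * (g * s1)" using g tpos by (simp add: s1_def D_def field_simps)
      also have "\<dots> \<le> (t - \<tau>) * \<bar>P (p + s1 *\<^sub>R \<eta>) - P p\<bar>"
        using half var tpos g s1 by (intro mult_mono) auto
      finally have turn: "B\<^sup>2 \<le> (t - \<tau>) * \<bar>P (p + s1 *\<^sub>R \<eta>) - P (p + 0 *\<^sub>R \<eta>)\<bar>" by simp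
      have "0 < P (p + 0 *\<^sub>R \<eta>)" "0 < P (p + s1 *\<^sub>R \<eta>)"
        using P_pos segN(1)[of 0] segN(1)[of s1] s1 by auto
      moreover have "P (p + 0 *\<^sub>R \<eta>) \<le> B" "P (p + s1 *\<^sub>R \<eta>) \<le> B"
        using segN(3)[of 0] segN(3)[of s1] s1 by auto
      moreover have "0 \<le> s1" "t - \<tau> > 0" using s1 half tpos by linarith+
      ultimately obtain s j where s: "0 \<le> s" "s \<le> s1" and j: "of_int j * P (p + s *\<^sub>R \<eta>) = t - \<tau>"
        using ivt_reciprocal_integer[OF _ cont, of B "t - \<tau>"] turn by metis
      define y where "y = p + s *\<^sub>R \<eta>"
      have yA: "y \<in> A" using seg[of s] s s1r by (simp add: y_def)
      have yN: "y \<in> N" using yA AN by blast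
      have "\<Phi> t y = \<Phi> \<tau> y"
        using \<Phi>_mod_P[OF yN, of \<tau> j] j by (simp add: y_def)
      then have "dist x (\<Phi> t y) = norm (\<Phi> \<tau> p - \<Phi> \<tau> y)"
        by (simp add: x\<tau> dist_norm)
      also have "\<dots> \<le> norm (p - y) * exp ((L + 1) * \<bar>\<tau>\<bar>)"
        using pN yN by (intro \<Phi>_dist) auto
      also have "\<dots> \<le> s1 * exp ((L + 1) * B)"
        using s \<tau> L_pos \<eta>(1) by (intro mult_mono) (auto simp: y_def)
      also have "\<dots> = C / t" by (simp add: s1_def C_def)
      finally show "\<exists>y\<in>A. dist x (\<Phi> t y) \<le> C / t" using yA by blast
    qed
  qed
qed

text \<open>For \<open>t \<ge> t1 \<ge> 1\<close> the rate \<open>1 / t\<close> is at most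
  \<open>2 / (1 + t)\<close>. Before \<open>t1\<close> the choice \<open>y = a\<close> suffices,
  because both points lie in the bounded set \<open>X\<close>; hence the term with the
  diameter.\<close>

lemma mixing_upper:
  assumes "r0 > 0" "0 < \<beta>0" "\<beta>0 < pi / 2" "\<kappa> > 0"
    and B: "B > 0" "\<And>x. x \<in> K \<Longrightarrow> P x \<le> B" "\<And>x. x \<in> K \<Longrightarrow> 1 \<le> B * norm (V x)" and K: "K \<subseteq> N"
  obtains C where "C > 0"
    "\<forall>A t x a. admissible K r0 \<beta>0 \<kappa> A \<and> 0 \<le> t \<and> a \<in> A \<and> x \<in> orbit \<Phi> {a} \<longrightarrow>
      (\<exists>y\<in>A. dist x (\<Phi> t y) \<le> C / (1 + t))"
proof -
  obtain t1 C where C: "t1 \<ge> 1" "C > 0"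
    "\<forall>A t x a. admissible K r0 \<beta>0 \<kappa> A \<and> t1 \<le> t \<and> a \<in> A \<and> x \<in> orbit \<Phi> {a} \<longrightarrow>
      (\<exists>y\<in>A. dist x (\<Phi> t y) \<le> C / t)"
    by (rule mixing_large_time[OF assms])
  define C' where "C' = max (2 * C) (diameter X * (1 + t1))"
  show ?thesis
  proof (rule that[of C'])
    show "C' > 0" using C by (simp add: C'_def less_max_iff_disj)
    show "\<forall>A t x a. admissible K r0 \<beta>0 \<kappa> A \<and> 0 \<le> t \<and> a \<in> A \<and> x \<in> orbit \<Phi> {a} \<longrightarrow>
      (\<exists>y\<in>A. dist x (\<Phi> t y) \<le> C' / (1 + t))"
    proof (intro allI impI; elim conjE)
      fix A and t :: real and x a
      assume A: "admissible K r0 \<beta>0 \<kappa> A" and t: "0 \<le> t" and a: "a \<in> A" and x: "x \<in> orbit \<Phi> {a}"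
      show "\<exists>y\<in>A. dist x (\<Phi> t y) \<le> C' / (1 + t)"
      proof (cases "t \<ge> t1")
        case True
        then obtain y where y: "y \<in> A" "dist x (\<Phi> t y) \<le> C / t"
          using C(3) A True a x by blast
        have "C / t \<le> C' / (1 + t)"
        proof -
          have "C * (1 + t) \<le> C * (2 * t)"
            using C True by (intro mult_left_mono) auto
          also have "\<dots> \<le> C' * t"
            using t by (simp add: C'_def mult.assoc[symmetric] mult.commute[of C] mult_right_mono)
          finally show ?thesis using C True by (simp add: field_simps)
        qed
        then show ?thesis using y by force
      next
        case False
        have aX: "a \<in> X" using a A K by (auto simp: admissible_def)
        then have "x \<in> X" using x by (auto simp: orbit_singleton)
        then have "dist x (\<Phi> t a) \<le> diameter X"
          using aX compact_X by (intro diameter_bounded_bound) (auto simp: compact_imp_bounded)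
        also have "\<dots> \<le> C' / (1 + t)"
        proof -
          have "diameter X * (1 + t) \<le> diameter X * (1 + t1)"
            using False diameter_ge_0[OF compact_imp_bounded[OF compact_X]] by (intro mult_left_mono) auto
          also have "\<dots> \<le> C'" by (simp add: C'_def)
          finally show ?thesis using t by (simp add: field_simps)
        qed
        finally show ?thesis using a by blast
      qed
    qed
  qed
qed

lemma mixing_bounds:
  assumes d: "d > 0" and "r0 > 0" "0 < \<beta>0" "\<beta>0 < pi / 2" "\<kappa> > 0"
  obtains C where "C > 0"
    "\<And>A t. admissible (away d) r0 \<beta>0 \<kappa> A \<Longrightarrow> t \<ge> 0 \<Longrightarrow>
      ereal (inverse C * inverse (1 + t)) * (SUP x0\<in>orbit \<Phi> A - A. esetdist {x0} (- (orbit \<Phi> A - A)))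
        \<le> rho (\<Phi> t ` (orbit \<Phi> A - A)) \<and>
      rho_rel \<Phi> A (\<Phi> t ` (orbit \<Phi> A - A)) \<le> ereal (C * inverse (1 + t))"
proof -
  obtain K where K: "compact K" "K \<subseteq> N" "away d \<subseteq> K" "\<And>t x. x \<in> K \<Longrightarrow> \<Phi> t x \<in> K"
    by (rule invariant_compact[OF away_compact away_subset[OF d]]) blast
  obtain B where B: "B > 0" "\<And>x. x \<in> K \<Longrightarrow> P x \<le> B" "\<And>x. x \<in> K \<Longrightarrow> 1 \<le> B * norm (V x)"
    by (rule compact_bounds[OF K(1,2)]) blast
  obtain Q where Q: "Q > 0"
    "\<And>a b t. a \<in> K \<Longrightarrow> b \<in> K \<Longrightarrow> norm (\<Phi> t a - \<Phi> t b) \<le> Q * (1 + \<bar>t\<bar>) * norm (a - b)"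
    by (rule \<Phi>_linear_growth[OF K(1,2)]) blast
  obtain C0 where C0: "C0 > 0"
    "\<forall>A t x a. admissible K r0 \<beta>0 \<kappa> A \<and> 0 \<le> t \<and> a \<in> A \<and> x \<in> orbit \<Phi> {a} \<longrightarrow>
      (\<exists>y\<in>A. dist x (\<Phi> t y) \<le> C0 / (1 + t))"
    by (rule mixing_upper[OF assms(2-5) B K(2)])
  have KX: "K \<subseteq> X" using K(2) by blast
  define C where "C = max Q C0"
  show ?thesis
  proof (rule that[of C])
    show "C > 0" using Q(1) by (simp add: C_def)
    fix A t
    assume A: "admissible (away d) r0 \<beta>0 \<kappa> A" and t: "t \<ge> (0::real)"
    have adm: "admissible K r0 \<beta>0 \<kappa> A" and AK: "A \<subseteq> \<Omega> \<inter> K"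
      using A K(3) by (auto simp: admissible_def)
    define E where "E = orbit \<Phi> A - A"
    have orbK: "orbit \<Phi> A \<subseteq> K" using AK K(4) by (auto simp: orbit_def)
    then have EK: "E \<subseteq> K" by (auto simp: E_def)
    have E't: "\<Phi> t ` E \<subseteq> K" using EK K(4) by blast
    \<comment> \<open>A bounded set has nonempty complement, so in the lower bound the value
      \<open>\<infinity>\<close> of \<open>esetdist\<close> does not occur.\<close>
    have ne: "- S \<noteq> {}" if "S \<subseteq> K" for S
    proof
      assume "- S = {}"
      then have "UNIV = K" using that by blast
      then show False
        using compact_imp_bounded[OF K(1)] not_bounded_UNIV[where 'a = "real^2"] by simp
    qed
    have le: "ereal (inverse C * inverse (1 + t)) * esetdist {x0} (- E) \<le> esetdist {\<Phi> t x0} (- (\<Phi> t ` E))"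
      if x0: "x0 \<in> E" for x0
    proof -
      define r where "r = setdist {x0} (- E)"
      have "inverse C * inverse (1 + t) * r \<le> setdist {\<Phi> t x0} (- (\<Phi> t ` E))"
      proof (cases "r > 0")
        case True
        have "ball x0 r \<subseteq> E"
        proof
          fix z assume z: "z \<in> ball x0 r"
          show "z \<in> E"
          proof (rule ccontr)
            assume "z \<notin> E"
            then have "r \<le> dist x0 z" unfolding r_def by (intro setdist_le_dist) auto
            then show False using z by simp
          qed
        qed
        then have b: "ball (\<Phi> t x0) (r / (Q * (1 + \<bar>t\<bar>))) \<subseteq> \<Phi> t ` E"
          using \<Phi>_ball_image[OF Q KX K(4) _ EK True, of x0 t] by blast
        have "r / (Q * (1 + \<bar>t\<bar>)) \<le> setdist {\<Phi> t x0} (- (\<Phi> t ` E))"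
        proof (rule le_setdistI)
          show "- \<Phi> t ` E \<noteq> {}" using ne[OF E't] .
          fix x y assume "x \<in> {\<Phi> t x0}" "y \<in> - \<Phi> t ` E"
          then have "x = \<Phi> t x0" "y \<notin> ball (\<Phi> t x0) (r / (Q * (1 + \<bar>t\<bar>)))" using b by auto
          then show "r / (Q * (1 + \<bar>t\<bar>)) \<le> dist x y" by simp
        qed simp
        moreover have "inverse C * inverse (1 + t) * r \<le> r / (Q * (1 + \<bar>t\<bar>))"
        proof -
          have "r / (C * (1 + t)) \<le> r / (Q * (1 + t))"
            using True t Q(1) by (intro divide_left_mono mult_right_mono) (auto simp: C_def intro: mult_pos_pos)
          then show ?thesis using t by (simp add: divide_simps mult_ac)
        qed
        ultimately show ?thesis by linarith
      next
        case False
        then have "r = 0" using setdist_pos_le[of "{x0}" "- E"] by (simp add: r_def)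
        then show ?thesis by simp
      qed
      then show ?thesis
        using ne[OF EK] ne[OF E't] by (simp add: esetdist_def r_def)
    qed
    have 1: "ereal (inverse C * inverse (1 + t)) * (SUP x0\<in>E. esetdist {x0} (- E)) \<le> rho (\<Phi> t ` E)"
    \<comment> \<open>An empty supremum is \<open>- \<infinity>\<close> on both sides and stays so
      after multiplication by a positive number; the factor is moved inside only for nonempty
      \<open>E\<close>.\<close>
    proof (cases "E = {}")
      case True
      show ?thesis using True \<open>C > 0\<close> t by (simp add: rho_def bot_ereal_def)
    next
      case False
      have "ereal (inverse C * inverse (1 + t)) * (SUP x0\<in>E. esetdist {x0} (- E)) =
          (SUP x0\<in>E. ereal (inverse C * inverse (1 + t)) * esetdist {x0} (- E))"
        using \<open>C > 0\<close> t by (intro SUP_ereal_mult_left[OF False, symmetric]) (auto simp: esetdist_def)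
      also have "\<dots> \<le> (SUP x\<in>\<Phi> t ` E. esetdist {x} (- (\<Phi> t ` E)))"
        using le by (intro SUP_least) (meson SUP_upper2 imageI)
      finally show ?thesis by (simp add: rho_def)
    qed
    have 2: "rho_rel \<Phi> A (\<Phi> t ` E) \<le> ereal (C * inverse (1 + t))"
      unfolding rho_rel_def
    proof (rule SUP_least)
      fix x assume "x \<in> \<Phi> t ` E"
      then obtain e where e: "e \<in> E" "x = \<Phi> t e" by blast
      then obtain a s where a: "a \<in> A" "e = \<Phi> s a" by (auto simp: E_def orbit_def)
      have aX: "a \<in> X" using a AK KX by blast
      have "x = \<Phi> (t + s) a" using e a \<Phi>_add[OF aX, of t s] by simp
      then have "x \<in> orbit \<Phi> {a}" by (auto simp: orbit_singleton)
      then obtain y where y: "y \<in> A" "dist x (\<Phi> t y) \<le> C0 / (1 + t)"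
        using C0(2) adm t a(1) by blast
      have yX: "y \<in> X" using y AK KX by blast
      \<comment> \<open>\<open>E\<close> avoids \<open>A\<close> and \<open>\<Phi> t\<close> is
        injective, so the image of a point of \<open>A\<close> is an admissible competitor in
        \<open>rho_rel\<close>.\<close>
      have "\<Phi> t y \<notin> \<Phi> t ` E"
      proof
        assume "\<Phi> t y \<in> \<Phi> t ` E"
        then obtain e' where e': "e' \<in> E" "\<Phi> t y = \<Phi> t e'" by blast
        moreover have "e' \<in> X" using e' EK KX by blast
        ultimately have "y = e'" using \<Phi>_inj[OF yX] by blast
        then show False using y e' by (simp add: E_def)
      qed
      moreover have "\<Phi> t y \<in> orbit \<Phi> A" using y by (auto simp: orbit_def)
      ultimately have in2: "\<Phi> t y \<in> - (\<Phi> t ` E) \<inter> orbit \<Phi> A" by blast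
      then have "esetdist {x} (- (\<Phi> t ` E) \<inter> orbit \<Phi> A) = ereal (setdist {x} (- (\<Phi> t ` E) \<inter> orbit \<Phi> A))"
        by (auto simp: esetdist_def)
      also have "\<dots> \<le> ereal (dist x (\<Phi> t y))"
        using in2 by (simp add: setdist_le_dist)
      also have "\<dots> \<le> ereal (C * inverse (1 + t))"
      proof -
        have "C0 / (1 + t) \<le> C * inverse (1 + t)"
          using t by (simp add: C_def divide_inverse mult_right_mono)
        then show ?thesis using y(2) by simp
      qed
      finally show "esetdist {x} (- (\<Phi> t ` E) \<inter> orbit \<Phi> A) \<le> ereal (C * inverse (1 + t))" .
    qed
    show "ereal (inverse C * inverse (1 + t)) * (SUP x0\<in>orbit \<Phi> A - A. esetdist {x0} (- (orbit \<Phi> A - A)))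
        \<le> rho (\<Phi> t ` (orbit \<Phi> A - A)) \<and>
      rho_rel \<Phi> A (\<Phi> t ` (orbit \<Phi> A - A)) \<le> ereal (C * inverse (1 + t))"
      using 1 2 unfolding E_def by blast
  qed
qed

end

section \<open>From the locale to the theorem\<close>

lemma rho_le_rho_rel: "rho F \<le> rho_rel \<Phi> A F"
  unfolding rho_def rho_rel_def
proof (rule SUP_mono)
  fix x assume "x \<in> F"
  \<comment> \<open>Fewer target points can only increase the distance, also when none is left,
    thanks to the convention \<open>\<infinity>\<close>.\<close>
  moreover have "esetdist {x} (- F) \<le> esetdist {x} (- F \<inter> orbit \<Phi> A)"
    by (auto simp: esetdist_def intro!: setdist_subset_right)
  ultimately show "\<exists>y\<in>F. esetdist {x} (- F) \<le> esetdist {y} (- F \<inter> orbit \<Phi> A)" by blast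
qed

text \<open>\<open>V'\<close> and \<open>L\<close> are chosen from \<open>V\<close> and the compact
  closure alone, before any flow, so the same constants fit every flow of \<open>V\<close>. The
  Lipschitz constant comes from local bounds and compactness, since the closure need not be
  convex.\<close>

lemma hamiltonian_flow_exists:
  assumes "bounded \<Omega>" "lipschitz_domain \<Omega>" "C1_closure \<Omega> V" and A1: "assm_A1 \<Omega> V H"
  obtains V' L where "\<And>\<Phi>. is_flow \<Omega> V \<Phi> \<Longrightarrow> hamiltonian_flow \<Omega> V V' H \<Phi> L"
proof -
  obtain U f' where U: "open U" "closure \<Omega> \<subseteq> U"
    and f': "\<And>x. x \<in> U \<Longrightarrow> (V has_derivative blinfun_apply (f' x)) (at x)" "continuous_on U f'"
    using assms(3) unfolding C1_closure_def C1_on_def by blast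
  have cpt: "compact (closure \<Omega>)" using assms(1) by (simp add: compact_closure)
  have "local_lipschitz (UNIV :: real set) U (\<lambda>_. V)"
  proof (rule c1_implies_local_lipschitz[where f' = "\<lambda>p. f' (snd p)"])
    show "continuous_on (UNIV \<times> U) (\<lambda>p. f' (snd p))"
      by (rule continuous_on_compose2[OF f'(2) continuous_on_snd[OF continuous_on_id]]) auto
  qed (simp_all add: U(1) f'(1))
  then have "local_lipschitz {0::real} (closure \<Omega>) (\<lambda>_. V)"
    by (rule local_lipschitz_subset) (use U in auto)
  then obtain L1 where L1: "\<And>t. t \<in> {0::real} \<Longrightarrow> L1-lipschitz_on (closure \<Omega>) V"
    by (rule local_lipschitz_compact_implies_lipschitz[OF _ cpt]) auto
  have bd: "\<exists>B. \<forall>x\<in>closure \<Omega>. norm (f x) \<le> B"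
    if "continuous_on U f" for f :: "real^2 \<Rightarrow> 'a::real_normed_vector"
    using compact_imp_bounded[OF compact_continuous_image[OF continuous_on_subset[OF that U(2)] cpt]]
    unfolding bounded_iff by auto
  have "continuous_on U V"
    using f'(1) by (intro continuous_at_imp_continuous_on) (auto intro: has_derivative_continuous)
  then obtain L2 where L2: "\<And>x. x \<in> closure \<Omega> \<Longrightarrow> norm (V x) \<le> L2" using bd by blast
  obtain L3 where L3: "\<And>x. x \<in> closure \<Omega> \<Longrightarrow> norm (f' x) \<le> L3" using bd[OF f'(2)] by blast
  define L where "L = Max {1, L1, L2, L3}"
  have L: "1 \<le> L" "L1 \<le> L" "L2 \<le> L" "L3 \<le> L" by (auto simp: L_def)
  show ?thesis
  proof (rule that)
    fix \<Phi> assume flow: "is_flow \<Omega> V \<Phi>"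
    show "hamiltonian_flow \<Omega> V f' H \<Phi> L"
    proof
      show "open \<Omega>" using assms(2) by (simp add: lipschitz_domain_def)
      show "L-lipschitz_on (closure \<Omega>) V" using L1 L(2) by (auto intro: lipschitz_on_le)
      show "norm (V x) \<le> L" "norm (f' x) \<le> L" if "x \<in> closure \<Omega>" for x
        using L2[OF that] L3[OF that] L by auto
      show "\<exists>\<delta>>0. \<forall>a\<in>closure \<Omega>. \<forall>b\<in>closure \<Omega>. dist a b < \<delta> \<longrightarrow>
        norm (V b - V a - blinfun_apply (f' a) (b - a)) \<le> \<epsilon> * norm (b - a)" if \<epsilon>: "\<epsilon> > 0" for \<epsilon>
      proof -
        obtain \<delta> where "\<delta> > 0" "\<And>a b. a \<in> closure \<Omega> \<Longrightarrow> dist a b < \<delta> \<Longrightarrow>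
            norm (V b - V a - blinfun_apply (f' a) (b - a)) \<le> \<epsilon> * norm (b - a)"
          by (rule C1_on_uniformly_differentiable[OF cpt U(2,1) f' \<epsilon>]) blast+
        then show ?thesis by blast
      qed
      show "GDERIV H x :> grad H x" for x
        using A1 by (simp add: assm_A1_def C2_def)
      show "continuous_on UNIV (grad H)"
      proof -
        obtain h' where "\<And>x. (grad H has_derivative blinfun_apply (h' x)) (at x)"
          using A1 unfolding assm_A1_def C2_def C1_on_def by blast
        then show ?thesis
          by (intro continuous_at_imp_continuous_on) (auto intro: has_derivative_continuous)
      qed
    qed (use flow assms L A1 in \<open>auto simp: assm_A1_def\<close>)
  qed
qed

theorem proposition5p1:
  fixes \<Omega> :: "(real^2) set" and V :: "real^2 \<Rightarrow> real^2"
    and d :: ereal and \<kappa> r0 \<beta>0 :: real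
  assumes "bounded \<Omega>" and "lipschitz_domain \<Omega>"
    and "C1_closure \<Omega> V" and "\<forall>x\<in>\<Omega>. divergence V x = 0" and "tangential \<Omega> V"
    and "\<exists>H. assm_A1 \<Omega> V H \<and> assm_A2 \<Omega> H"
    and "d > 0" and "\<kappa> > 0" and "r0 > 0" and "0 < \<beta>0" and "\<beta>0 < pi / 2"
  shows "\<exists>C>0. \<forall>\<Phi> A. is_flow \<Omega> V \<Phi> \<and>
    A \<noteq> {} \<and> open A \<and> A \<subseteq> \<Omega> \<and> \<not> flow_invariant \<Phi> (closure A) \<and>
    orbit_cone_condition \<Phi> A r0 \<beta>0 \<and>
    d = esetdist A (degenerate_set \<Omega> \<Phi>) \<and>
    \<kappa> = (INF x\<in>A. norm (grad_period \<Phi> x)) \<longrightarrow>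
    (let E = orbit \<Phi> A - A in
      \<forall>t\<ge>0.
        ereal (inverse C * inverse (1 + t)) * (SUP x0\<in>E. esetdist {x0} (- E)) \<le> rho (\<Phi> t ` E) \<and>
        rho (\<Phi> t ` E) \<le> rho_rel \<Phi> A (\<Phi> t ` E) \<and>
        rho_rel \<Phi> A (\<Phi> t ` E) \<le> ereal (C * inverse (1 + t)))"
\<comment> \<open>\<open>C\<close> must be named before the flow. It is computed from one flow
  \<open>\<Phi>0\<close>, with which any other flow agrees on the closure by uniqueness; if there is
  none, the claim is vacuous.\<close>
proof (cases "\<exists>\<Phi>. is_flow \<Omega> V \<Phi>")
  case True
  then obtain \<Phi>0 where \<Phi>0: "is_flow \<Omega> V \<Phi>0" by blast
  obtain H where H: "assm_A1 \<Omega> V H" using assms(6) by blast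
  obtain V' L where loc: "\<And>\<Phi>. is_flow \<Omega> V \<Phi> \<Longrightarrow> hamiltonian_flow \<Omega> V V' H \<Phi> L"
    by (rule hamiltonian_flow_exists[OF assms(1-3) H]) blast
  interpret F: hamiltonian_flow \<Omega> V V' H \<Phi>0 L by (rule loc[OF \<Phi>0])
  \<comment> \<open>\<open>d\<close> may be \<open>\<infinity>\<close>, namely when there are no
    degenerate points; a positive real number below it is enough and is chosen from \<open>d\<close>
    alone.\<close>
  obtain d0 :: real where d0: "d0 > 0" "ereal d0 \<le> d"
    using ereal_dense2[OF assms(7)] by (auto simp: zero_ereal_def intro: less_imp_le)
  obtain C where C: "C > 0"
    "\<And>A t. F.admissible (F.away d0) r0 \<beta>0 \<kappa> A \<Longrightarrow> t \<ge> 0 \<Longrightarrow>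
      ereal (inverse C * inverse (1 + t)) * (SUP x0\<in>orbit \<Phi>0 A - A. esetdist {x0} (- (orbit \<Phi>0 A - A)))
        \<le> rho (\<Phi>0 t ` (orbit \<Phi>0 A - A)) \<and>
      rho_rel \<Phi>0 A (\<Phi>0 t ` (orbit \<Phi>0 A - A)) \<le> ereal (C * inverse (1 + t))"
    by (rule F.mixing_bounds[OF d0(1) assms(9-11,8)]) blast
  show ?thesis
  proof (intro exI[of _ C] conjI allI impI; (elim conjE)?)
    fix \<Phi> A
    assume \<Phi>: "is_flow \<Omega> V \<Phi>" and A: "A \<noteq> {}" "open A" "A \<subseteq> \<Omega>" "orbit_cone_condition \<Phi> A r0 \<beta>0"
      and d: "d = esetdist A (degenerate_set \<Omega> \<Phi>)" and \<kappa>: "\<kappa> = (INF x\<in>A. norm (grad_period \<Phi> x))"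
    interpret G: hamiltonian_flow \<Omega> V V' H \<Phi> L by (rule loc[OF \<Phi>])
    have eq: "\<Phi> t x = \<Phi>0 t x" if "x \<in> closure \<Omega>" for t x
      using F.solution_unique[of "\<lambda>t. \<Phi> t x" t] G.\<Phi>_deriv[OF that] that by simp
    have \<Omega>X: "\<Omega> \<subseteq> closure \<Omega>" by (rule closure_subset)
    then have AX: "A \<subseteq> closure \<Omega>" using A by blast
    have orb: "orbit \<Phi> S = orbit \<Phi>0 S" if "S \<subseteq> closure \<Omega>" for S
      unfolding orbit_def using eq that by (intro SUP_cong image_cong) auto
    have per: "period \<Phi> x = period \<Phi>0 x" if "x \<in> closure \<Omega>" for x
      unfolding period_def using eq[OF that] by simp
    then have deg: "degenerate_set \<Omega> \<Phi> = degenerate_set \<Omega> \<Phi>0"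
      unfolding degenerate_set_def by auto
    have PP: "G.P x = F.P x" if "x \<in> closure \<Omega>" for x
      using per[OF that] by (simp add: F.P_def G.P_def)
    have away: "A \<subseteq> \<Omega> \<inter> F.away d0"
    proof
      fix x assume x: "x \<in> A"
      have "d0 \<le> dist x z" if z: "z \<in> degenerate_set \<Omega> \<Phi>0" for z
      proof -
        have "A \<noteq> {}" "degenerate_set \<Omega> \<Phi>0 \<noteq> {}" using x z by auto
        then have "ereal d0 \<le> ereal (setdist A (degenerate_set \<Omega> \<Phi>))"
          using d0(2) unfolding d deg by (simp add: esetdist_def)
        also have "\<dots> \<le> ereal (dist x z)"
          using x z unfolding deg by (simp add: setdist_le_dist)
        finally show ?thesis by simp
      qed
      then show "x \<in> \<Omega> \<inter> F.away d0" using x A AX by (auto simp: F.away_def)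
    qed
    have cone: "orbit_cone_condition \<Phi>0 A r0 \<beta>0"
    proof -
      have "orbit \<Phi> {x} = orbit \<Phi>0 {x}" if "x \<in> A" for x
        using that AX by (intro orb) auto
      then show ?thesis
        using A(4) by (simp add: orbit_cone_condition_def cong: ball_cong_simp)
    qed
    have grad: "\<forall>x\<in>A. \<kappa> \<le> norm (grad F.P x)"
    proof
      fix x assume x: "x \<in> A"
      have "x \<in> G.N" using away F.away_subset[OF d0(1)] x deg by auto
      then have "GDERIV G.P x :> grad G.P x"
        using x A(3) by (intro G.P_gradient) auto
      \<comment> \<open>The two period functions are known to agree only on the closure, so the
        derivative is transferred through the open set \<open>\<Omega>\<close>.\<close>
      then have "GDERIV F.P x :> grad G.P x"
        unfolding gderiv_def
        by (rule has_derivative_transform_within_open[OF _ G.open_domain]) (use x A(3) PP \<Omega>X in auto)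
      then have "grad F.P x = grad G.P x" by (rule grad_eqI)
      moreover have "grad G.P = grad_period \<Phi>"
        by (simp add: grad_period_def G.P_def[abs_def])
      moreover have "\<kappa> \<le> norm (grad_period \<Phi> x)"
        unfolding \<kappa> using x by (intro cINF_lower bdd_belowI2[of _ 0]) auto
      ultimately show "\<kappa> \<le> norm (grad F.P x)" by simp
    qed
    have adm: "F.admissible (F.away d0) r0 \<beta>0 \<kappa> A"
      using away cone grad by (simp add: F.admissible_def)
    define E where "E = orbit \<Phi> A - A"
    have EX: "E \<subseteq> closure \<Omega>" using AX by (auto simp: E_def orbit_def)
    show "let E = orbit \<Phi> A - A in
      \<forall>t\<ge>0.
        ereal (inverse C * inverse (1 + t)) * (SUP x0\<in>E. esetdist {x0} (- E)) \<le> rho (\<Phi> t ` E) \<and>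
        rho (\<Phi> t ` E) \<le> rho_rel \<Phi> A (\<Phi> t ` E) \<and>
        rho_rel \<Phi> A (\<Phi> t ` E) \<le> ereal (C * inverse (1 + t))"
      unfolding Let_def E_def[symmetric]
    proof (intro allI impI)
      fix t :: real assume t: "0 \<le> t"
      have "\<Phi> t ` E = \<Phi>0 t ` E" using eq EX by (intro image_cong) auto
      moreover have "rho_rel \<Phi> A = rho_rel \<Phi>0 A"
        using orb[OF AX] by (simp add: rho_rel_def fun_eq_iff)
      ultimately show "ereal (inverse C * inverse (1 + t)) * (SUP x0\<in>E. esetdist {x0} (- E)) \<le> rho (\<Phi> t ` E) \<and>
        rho (\<Phi> t ` E) \<le> rho_rel \<Phi> A (\<Phi> t ` E) \<and>
        rho_rel \<Phi> A (\<Phi> t ` E) \<le> ereal (C * inverse (1 + t))"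
        using C(2)[OF adm t] rho_le_rho_rel[of "\<Phi> t ` E" \<Phi> A]
        unfolding E_def orb[OF AX] by simp
    qed
  qed (use C in simp)
next
  case False
  then show ?thesis by (intro exI[of _ 1]) auto
qed

end
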